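(* Let $\mathbb{F}$ be an arbitrary field. Let $G$ be a planar near-triangulation, and let $e=ab$ be a fixed edge of the outer cycle of $G$. Let $v_1,\dots,v_k$ be the vertices of the outer cycle other than $a$ and $b$, and let $u_1,\dots,u_l$ be the interior vertices of $G$ (the vertices not on the outer cycle). Put $$Q_{G-e}=\prod_{xy\in E(G)\setminus\{e\}}\left(\frac1x-\frac1y\right),\qquad R_{G-e}=v_1^2v_2^2\cdots v_k^2\,u_1^4u_2^4\cdots u_l^4 .$$ Then the Laurent polynomial $Z_{G-e}=Q_{G-e}\cdot R_{G-e}$ over $\mathbb{F}$ is good, i.e. at least one monomial with all exponents nonnegative appears in $Z_{G-e}$ with nonzero coefficient in $\mathbb{F}$.
   Context: Graphs are finite and simple. A planar near-triangulation is a plane graph whose outer face is bounded by a cycle (the outer cycle) and all of whose bounded faces are triangles. The vertices of $G$ are treated as commuting variables, and the expressions are Laurent polynomials in these variables, i.e. elements of $\mathbb{F}[x,x^{-1}: x\in V(G)]$. In the product defining $Q_{G-e}$ each edge is taken once with an arbitrarily fixed order of its two endpoints (changing the order only changes the overall sign). $G-e$ denotes the graph obtained by deleting the edge $e$ (keeping its endpoints). *)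

theory Defs
  imports "HOL-Analysis.Analysis" "HOL-Library.Poly_Mapping"
begin

text \<open>
  Plane graphs are drawn in the complex plane: a finite simple graph with vertex set \<open>V\<close> and
  edge set \<open>E\<close> (two-element subsets of \<open>V\<close>), a point \<open>pos v\<close> for every vertex, and a simple arc
  \<open>\<gamma> e\<close> for every edge, whose direction of traversal is irrelevant.
\<close>

locale plane_graph =
  fixes V :: "'v set"
    and E :: "'v set set"
    and pos :: "'v \<Rightarrow> complex"
    and \<gamma> :: "'v set \<Rightarrow> real \<Rightarrow> complex"
  assumes finite_verts: "finite V"
    and simple_edges: "e \<in> E \<Longrightarrow> e \<subseteq> V \<and> card e = 2"
    and pos_inj: "inj_on pos V"
    and edge_arc: "e \<in> E \<Longrightarrow> arc (\<gamma> e)"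
    and edge_ends: "e \<in> E \<Longrightarrow> {pathstart (\<gamma> e), pathfinish (\<gamma> e)} = pos ` e"
    and edge_avoids_verts: "e \<in> E \<Longrightarrow> path_image (\<gamma> e) \<inter> pos ` V = pos ` e"
    and edges_noncrossing:
      "e \<in> E \<Longrightarrow> f \<in> E \<Longrightarrow> e \<noteq> f \<Longrightarrow> path_image (\<gamma> e) \<inter> path_image (\<gamma> f) = pos ` (e \<inter> f)"
begin

definition drawing :: "complex set" where
  "drawing = pos ` V \<union> (\<Union>e\<in>E. path_image (\<gamma> e))"

definition faces :: "complex set set" where
  "faces = components (- drawing)"

end

definition cycle_edges :: "'v list \<Rightarrow> 'v set set" where
  "cycle_edges c = {{c ! i, c ! (Suc i mod length c)} | i. i < length c}"

definition is_cycle :: "'v set set \<Rightarrow> 'v list \<Rightarrow> bool" where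
  "is_cycle E c \<longleftrightarrow> 3 \<le> length c \<and> distinct c \<and> cycle_edges c \<subseteq> E"

context plane_graph
begin

definition bounded_by :: "complex set \<Rightarrow> 'v list \<Rightarrow> bool" where
  "bounded_by S c \<longleftrightarrow> is_cycle E c \<and> frontier S = (\<Union>e\<in>cycle_edges c. path_image (\<gamma> e))"

end

text \<open>
  The complement of a drawing is the complement of a compact set in the plane and so has exactly
  one unbounded component, the outer face.
\<close>

locale near_triangulation = plane_graph V E pos \<gamma>
  for V :: "'v set" and E and pos and \<gamma> +
  fixes C :: "'v list"
  assumes outer_cycle: "S \<in> faces \<Longrightarrow> \<not> bounded S \<Longrightarrow> bounded_by S C"
    and inner_triangles: "S \<in> faces \<Longrightarrow> bounded S \<Longrightarrow> \<exists>t. length t = 3 \<and> bounded_by S t"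

text \<open>
  The Laurent polynomials over \<open>'f\<close> in commuting variables indexed by \<open>'v\<close> form the group algebra
  of the free abelian group \<open>'v \<Rightarrow>\<^sub>0 int\<close> of exponent vectors; its multiplication is convolution.
\<close>

type_synonym ('v, 'f) laurent_poly = "('v \<Rightarrow>\<^sub>0 int) \<Rightarrow>\<^sub>0 'f"

definition lvar :: "'v \<Rightarrow> ('v, 'f :: field) laurent_poly" where
  "lvar x = Poly_Mapping.single (Poly_Mapping.single x 1) 1"

definition lvar_inv :: "'v \<Rightarrow> ('v, 'f :: field) laurent_poly" where
  "lvar_inv x = Poly_Mapping.single (Poly_Mapping.single x (- 1)) 1"

lemma lvar_mult_lvar_inv: "lvar x * lvar_inv x = 1"
  by (simp add: lvar_def lvar_inv_def mult_single flip: single_add)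

definition good :: "('v, 'f :: field) laurent_poly \<Rightarrow> bool" where
  "good p \<longleftrightarrow> (\<exists>m. (\<forall>x. 0 \<le> Poly_Mapping.lookup m x) \<and> Poly_Mapping.lookup p m \<noteq> 0)"

text \<open>An ordering of the two endpoints of every edge in \<open>E\<close>.\<close>

definition edge_ordering :: "'v set set \<Rightarrow> ('v set \<Rightarrow> 'v \<times> 'v) \<Rightarrow> bool" where
  "edge_ordering E ends \<longleftrightarrow> (\<forall>e\<in>E. e = {fst (ends e), snd (ends e)})"

definition Q_poly :: "'v set set \<Rightarrow> ('v set \<Rightarrow> 'v \<times> 'v) \<Rightarrow> ('v, 'f :: field) laurent_poly" where
  "Q_poly E ends = (\<Prod>e\<in>E. lvar_inv (fst (ends e)) - lvar_inv (snd (ends e)))"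

definition R_poly :: "'v set \<Rightarrow> 'v list \<Rightarrow> 'v set \<Rightarrow> ('v, 'f :: field) laurent_poly" where
  "R_poly V C e = (\<Prod>v\<in>set C - e. lvar v ^ 2) * (\<Prod>u\<in>V - set C. lvar u ^ 4)"

end

theory Submission
  imports Defs
begin

text \<open>
  A monomial of \<open>Q\<close> is nice if it has exponent \<open>0\<close> at \<open>a\<close> and \<open>b\<close>, at least \<open>- 2\<close> on the outer cycle and
  at least \<open>- 4\<close> everywhere. Fix the drawing and argue by induction for the part of the graph
  enclosed by a cycle, with a root edge \<open>ab\<close> on it. Let \<open>v\<close> be the neighbour of \<open>a\<close> on the cycle
  other than \<open>b\<close>. A chord at \<open>v\<close> splits the enclosed part into two, with the chord as the root
  edge of the second; since \<open>Q\<close> is homogeneous, the product of two nice monomials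
  arises in only one way. Without a chord the neighbours of \<open>v\<close> form a path from \<open>a\<close> through
  enclosed vertices to the next vertex \<open>q\<close> of the cycle, and \<open>v\<close> can be deleted. All planarity used
  is that a simple arc inside a Jordan curve cuts its inside into the insides of the two
  curves of the theta graph, and that each edge of the cycle lies on a triangular face inside it.
\<close>

section \<open>Laurent monomials of edge products\<close>

text \<open>If no other pair of keys sums to \<open>m + n\<close>, the convolution has a single term
  and nothing can cancel. By cancellation it suffices to compare the first components. Coefficients
  of products are shown to be nonzero in this way, which works over every field.\<close>

lemma lookup_mult_unique_pair:
  fixes p q :: "'a::cancel_comm_monoid_add \<Rightarrow>\<^sub>0 'b::semiring_0"
  assumes "\<And>k l. k \<in> Poly_Mapping.keys p \<Longrightarrow> l \<in> Poly_Mapping.keys q \<Longrightarrow> k + l = m + n \<Longrightarrow> k = m"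
  shows "Poly_Mapping.lookup (p * q) (m + n) = Poly_Mapping.lookup p m * Poly_Mapping.lookup q n"
proof -
  define g where "g l = (\<Sum>k. Poly_Mapping.lookup q k when m + n = l + k)" for l
  have gm: "g m = Poly_Mapping.lookup q n"
  proof -
    have "g m = (\<Sum>k\<in>{n}. Poly_Mapping.lookup q k when m + n = m + k)"
      unfolding g_def by (rule Sum_any.expand_superset) (auto simp: when_def)
    then show ?thesis by simp
  qed
  have off: "Poly_Mapping.lookup p l * g l = 0" if "l \<noteq> m" for l
  proof (cases "l \<in> Poly_Mapping.keys p")
    case True
    then have "(Poly_Mapping.lookup q k when m + n = l + k) = 0" for k
      using assms[of l k] that by (cases "m + n = l + k") (auto simp: in_keys_iff)
    then have "g l = 0" unfolding g_def by simp
    then show ?thesis by simp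
  qed (simp add: in_keys_iff)
  have "Poly_Mapping.lookup (p * q) (m + n) = (\<Sum>l. Poly_Mapping.lookup p l * g l)"
    by (simp add: lookup_mult g_def)
  also have "\<dots> = (\<Sum>l\<in>{m}. Poly_Mapping.lookup p l * g l)"
    using off by (intro Sum_any.expand_superset) auto
  finally show ?thesis by (simp add: gm)
qed

lemma keys_edge_factor:
  fixes x y :: 'v
  shows "Poly_Mapping.keys (lvar_inv x - lvar_inv y :: ('v, 'f::field) laurent_poly)
    \<subseteq> {Poly_Mapping.single x (-1), Poly_Mapping.single y (-1)}"
  unfolding lvar_inv_def using keys_diff by fastforce

text \<open>Expanding the product means choosing one endpoint of every edge, and each choice lowers
  the exponent of that endpoint by one. The last part is homogeneity; \<open>U\<close> may contain
  vertices that lie on no edge of \<open>F\<close>.\<close>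

lemma keys_Q_poly:
  assumes "finite F" "edge_ordering F ends" "\<forall>e\<in>F. card e = 2"
    and "m \<in> Poly_Mapping.keys (Q_poly F ends :: ('v, 'f::field) laurent_poly)"
  shows "Poly_Mapping.lookup m x \<le> 0"
    and "x \<notin> \<Union>F \<Longrightarrow> Poly_Mapping.lookup m x = 0"
    and "finite U \<Longrightarrow> \<Union>F \<subseteq> U \<Longrightarrow> (\<Sum>u\<in>U. Poly_Mapping.lookup m u) = - int (card F)"
proof -
  have "(\<forall>x. Poly_Mapping.lookup m x \<le> 0 \<and> (x \<notin> \<Union>F \<longrightarrow> Poly_Mapping.lookup m x = 0)) \<and>
    (\<forall>U. finite U \<longrightarrow> \<Union>F \<subseteq> U \<longrightarrow> (\<Sum>u\<in>U. Poly_Mapping.lookup m u) = - int (card F))"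
    using assms
  proof (induction F arbitrary: m rule: finite_induct)
    case empty
    then show ?case by (simp add: Q_poly_def flip: single_one)
  next
    case (insert e F)
    let ?x = "fst (ends e)" and ?y = "snd (ends e)"
    have e: "e = {?x, ?y}"
      using insert.prems(1) by (simp add: edge_ordering_def)
    have "Q_poly (insert e F) ends = (lvar_inv ?x - lvar_inv ?y) * (Q_poly F ends :: ('v, 'f) laurent_poly)"
      using insert.hyps by (simp add: Q_poly_def)
    then obtain k l where kl: "m = k + l"
      "k \<in> Poly_Mapping.keys (lvar_inv ?x - lvar_inv ?y :: ('v, 'f) laurent_poly)"
      "l \<in> Poly_Mapping.keys (Q_poly F ends :: ('v, 'f) laurent_poly)"
      using insert.prems(3) keys_mult by fastforce
    obtain z where z: "z \<in> e" "k = Poly_Mapping.single z (-1)"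
      using kl(2) keys_edge_factor e by fastforce
    have IH: "(\<forall>x. Poly_Mapping.lookup l x \<le> 0 \<and> (x \<notin> \<Union>F \<longrightarrow> Poly_Mapping.lookup l x = 0)) \<and>
       (\<forall>U. finite U \<longrightarrow> \<Union>F \<subseteq> U \<longrightarrow> (\<Sum>u\<in>U. Poly_Mapping.lookup l u) = - int (card F))"
      using insert kl by (simp add: edge_ordering_def)
    have "(\<Sum>u\<in>U. Poly_Mapping.lookup m u) = - int (card (insert e F))"
      if "finite U" "\<Union>(insert e F) \<subseteq> U" for U
    proof -
      have "(\<Sum>u\<in>U. Poly_Mapping.lookup k u) = -1"
        using that z by (auto simp: lookup_single when_def)
      then show ?thesis using IH that insert.hyps by (simp add: kl(1) lookup_add sum.distrib)
    qed
    moreover have "Poly_Mapping.lookup m x \<le> 0 \<and> (x \<notin> \<Union>(insert e F) \<longrightarrow> Poly_Mapping.lookup m x = 0)" for x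
    proof -
      have "Poly_Mapping.lookup k x \<le> 0" "x \<notin> e \<Longrightarrow> Poly_Mapping.lookup k x = 0"
        using z by (auto simp: lookup_single when_def)
      moreover have "Poly_Mapping.lookup l x \<le> 0" "x \<notin> \<Union>F \<Longrightarrow> Poly_Mapping.lookup l x = 0"
        using IH by blast+
      ultimately show ?thesis by (simp add: kl(1) lookup_add)
    qed
    ultimately show ?case by blast
  qed
  then show "Poly_Mapping.lookup m x \<le> 0"
    and "x \<notin> \<Union>F \<Longrightarrow> Poly_Mapping.lookup m x = 0"
    and "finite U \<Longrightarrow> \<Union>F \<subseteq> U \<Longrightarrow> (\<Sum>u\<in>U. Poly_Mapping.lookup m u) = - int (card F)"
    by blast+
qed

lemma Q_poly_Un:
  "finite F \<Longrightarrow> finite G \<Longrightarrow> F \<inter> G = {} \<Longrightarrow> Q_poly (F \<union> G) ends = Q_poly F ends * Q_poly G ends"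
  by (simp add: Q_poly_def prod.union_disjoint)

section \<open>Products over the edges at one vertex\<close>

definition star :: "'v \<Rightarrow> 'v set \<Rightarrow> 'v set set" where
  "star v N = (\<lambda>w. {v, w}) ` N"

text \<open>The monomial that arises when \<open>v\<close> is chosen from the edges to
  \<open>S\<close> and the other end from each remaining edge.\<close>

definition star_mono :: "'v \<Rightarrow> 'v set \<Rightarrow> 'v set \<Rightarrow> 'v \<Rightarrow>\<^sub>0 int" where
  "star_mono v N S = Poly_Mapping.single v (- int (card S)) + (\<Sum>w\<in>N - S. Poly_Mapping.single w (-1))"

lemma lookup_star_mono:
  assumes "finite N" "v \<notin> N"
  shows "Poly_Mapping.lookup (star_mono v N S) x =
    (if x = v then - int (card S) else if x \<in> N - S then -1 else 0)"
proof -
  have "(\<Sum>w\<in>N - S. Poly_Mapping.lookup (Poly_Mapping.single w (- 1 :: int)) x) = (if x \<in> N - S then -1 else 0)"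
    using assms by (simp add: lookup_single when_def)
  then show ?thesis
    using assms by (auto simp: star_mono_def lookup_add lookup_sum lookup_single)
qed

lemma finite_star: "finite N \<Longrightarrow> finite (star v N)"
  by (simp add: star_def)

text \<open>The exponents on \<open>N\<close> reveal from which edges \<open>v\<close> was chosen,
  so different sets \<open>S\<close> give different monomials and no two choices cancel. The
  induction peels off one edge at a time.\<close>

lemma Q_poly_star:
  fixes ends :: "'v set \<Rightarrow> 'v \<times> 'v" and v :: 'v
  assumes "finite N" "v \<notin> N" "edge_ordering (star v N) ends"
  shows "Poly_Mapping.keys (Q_poly (star v N) ends :: ('v, 'f::field) laurent_poly) \<subseteq> star_mono v N ` Pow N"
    and "S \<subseteq> N \<Longrightarrow> Poly_Mapping.lookup (Q_poly (star v N) ends :: ('v, 'f) laurent_poly) (star_mono v N S) \<noteq> 0"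
proof -
  let ?Q = "\<lambda>N. Q_poly (star v N) ends :: ('v, 'f) laurent_poly"
  have "Poly_Mapping.keys (?Q N) \<subseteq> star_mono v N ` Pow N \<and>
     (\<forall>S\<subseteq>N. Poly_Mapping.lookup (?Q N) (star_mono v N S) \<noteq> 0)"
    using assms
  proof (induction N rule: finite_induct)
    case empty
    then show ?case by (simp add: star_def Q_poly_def star_mono_def lookup_one)
  next
    case (insert w N)
    let ?x = "fst (ends {v,w})" and ?y = "snd (ends {v,w})"
    define f where "f = (lvar_inv ?x - lvar_inv ?y :: ('v, 'f) laurent_poly)"
    have "{v,w} = {?x, ?y}"
      using insert.prems(2) by (simp add: edge_ordering_def star_def)
    moreover have "v \<noteq> w"
      using insert.prems(1) by simp
    ultimately have vw: "{v,w} = {?x, ?y}" "v \<noteq> w" .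
    have "star v (insert w N) = insert {v,w} (star v N)" "{v,w} \<notin> star v N"
      using insert.hyps by (auto simp: star_def doubleton_eq_iff)
    then have Q: "?Q (insert w N) = f * ?Q N"
      using insert.hyps by (simp add: Q_poly_def f_def finite_star)
    have kf: "Poly_Mapping.keys f \<subseteq> {Poly_Mapping.single v (-1), Poly_Mapping.single w (-1)}"
      using keys_edge_factor[of ?x ?y] vw by (auto simp: f_def doubleton_eq_iff)
    have ne: "Poly_Mapping.single v (-1) \<noteq> (Poly_Mapping.single w (-1) :: 'v \<Rightarrow>\<^sub>0 int)"
      using vw(2) by (metis lookup_single_eq lookup_single_not_eq zero_neq_neg_one)
    have fv: "Poly_Mapping.lookup f (Poly_Mapping.single v (-1)) \<noteq> 0"
      and fw: "Poly_Mapping.lookup f (Poly_Mapping.single w (-1)) \<noteq> 0"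
      using vw ne by (auto simp: f_def lvar_inv_def lookup_minus lookup_single doubleton_eq_iff)
    have IH: "Poly_Mapping.keys (?Q N) \<subseteq> star_mono v N ` Pow N"
      "\<And>S. S \<subseteq> N \<Longrightarrow> Poly_Mapping.lookup (?Q N) (star_mono v N S) \<noteq> 0"
      using insert by (auto simp: edge_ordering_def star_def)
    have mono_w: "star_mono v (insert w N) S = Poly_Mapping.single w (-1) + star_mono v N S"
      if "S \<subseteq> N" for S
      using that insert.hyps insert.prems
      by (intro poly_mapping_eqI) (auto simp: lookup_star_mono lookup_add lookup_single when_def)
    have mono_v: "star_mono v (insert w N) (insert w S) = Poly_Mapping.single v (-1) + star_mono v N S"
      if "S \<subseteq> N" for S
    proof -
      have "finite S" "w \<notin> S" using that insert.hyps finite_subset by auto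
      then show ?thesis
        using that insert.hyps insert.prems
        by (intro poly_mapping_eqI) (auto simp: lookup_star_mono lookup_add lookup_single when_def)
    qed
    have w0: "Poly_Mapping.lookup l w = 0" if l: "l \<in> Poly_Mapping.keys (?Q N)" for l
    proof -
      obtain S where "S \<subseteq> N" "l = star_mono v N S" using subsetD[OF IH(1) l] by (auto elim: imageE)
      then show ?thesis using insert.hyps insert.prems by (auto simp: lookup_star_mono)
    qed
    \<comment> \<open>No key of \<open>?Q N\<close> involves \<open>w\<close>, so the exponent of
      \<open>w\<close> alone tells which end the factor \<open>f\<close> contributes.\<close>
    have uniq: "k = m" if "k \<in> Poly_Mapping.keys f" "l \<in> Poly_Mapping.keys (?Q N)" "k + l = m + n"
      "m \<in> {Poly_Mapping.single v (-1), Poly_Mapping.single w (-1)}" "n \<in> Poly_Mapping.keys (?Q N)" for k l m n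
    proof -
      have "Poly_Mapping.lookup k w = Poly_Mapping.lookup m w"
        using arg_cong[OF that(3), of "\<lambda>p. Poly_Mapping.lookup p w"] w0[OF that(2)] w0[OF that(5)]
        by (simp add: lookup_add)
      moreover have "k \<in> {Poly_Mapping.single v (-1), Poly_Mapping.single w (-1)}"
        using subsetD[OF kf that(1)] .
      ultimately show ?thesis using that(4) vw(2) by (elim insertE emptyE) (simp_all add: lookup_single)
    qed
    show ?case
    proof (intro conjI allI impI)
      show "Poly_Mapping.keys (?Q (insert w N)) \<subseteq> star_mono v (insert w N) ` Pow (insert w N)"
      proof
        fix m assume "m \<in> Poly_Mapping.keys (?Q (insert w N))"
        then obtain k l where kl: "m = k + l" "k \<in> Poly_Mapping.keys f" "l \<in> Poly_Mapping.keys (?Q N)"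
          unfolding Q using keys_mult by fastforce
        obtain S where S: "S \<subseteq> N" "l = star_mono v N S" using subsetD[OF IH(1) kl(3)] by (auto elim: imageE)
        have "m = star_mono v (insert w N) S \<or> m = star_mono v (insert w N) (insert w S)"
          using kl kf S mono_w mono_v by auto
        then show "m \<in> star_mono v (insert w N) ` Pow (insert w N)" using S by blast
      qed
      fix S assume S: "S \<subseteq> insert w N"
      define S' where "S' = S - {w}"
      have S': "S' \<subseteq> N" using S by (auto simp: S'_def)
      then have nk: "star_mono v N S' \<in> Poly_Mapping.keys (?Q N)"
        using IH(2) by (simp add: in_keys_iff)
      obtain u where u: "u \<in> {v, w}" "star_mono v (insert w N) S = Poly_Mapping.single u (-1) + star_mono v N S'"
        using mono_w[OF S'] mono_v[OF S'] by (cases "w \<in> S") (auto simp: S'_def insert_absorb)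
      have "Poly_Mapping.lookup (?Q (insert w N)) (star_mono v (insert w N) S) =
         Poly_Mapping.lookup f (Poly_Mapping.single u (-1)) * Poly_Mapping.lookup (?Q N) (star_mono v N S')"
        unfolding Q u(2) by (rule lookup_mult_unique_pair) (erule (2) uniq, use nk u(1) in auto)
      then show "Poly_Mapping.lookup (?Q (insert w N)) (star_mono v (insert w N) S) \<noteq> 0"
        using fv fw u(1) IH(2)[OF S'] by auto
    qed
  qed
  then show "Poly_Mapping.keys (?Q N) \<subseteq> star_mono v N ` Pow N"
    and "S \<subseteq> N \<Longrightarrow> Poly_Mapping.lookup (?Q N) (star_mono v N S) \<noteq> 0" by blast+
qed


section \<open>Nice monomials: gluing along an edge and adding a vertex\<close>

definition nice_mono :: "'v set \<Rightarrow> 'v set \<Rightarrow> ('v \<Rightarrow>\<^sub>0 int) \<Rightarrow> bool" where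
  "nice_mono R B m \<longleftrightarrow> (\<forall>x\<in>R. Poly_Mapping.lookup m x = 0) \<and>
     (\<forall>x\<in>B. -2 \<le> Poly_Mapping.lookup m x) \<and> (\<forall>x. -4 \<le> Poly_Mapping.lookup m x)"

text \<open>Let \<open>k + l\<close> be another factorisation of \<open>m1 + m2\<close>. Away from
  \<open>x\<close> and \<open>y\<close> every vertex belongs to one side only, so \<open>l\<close>
  agrees with \<open>m2\<close> there; at \<open>x\<close> and \<open>y\<close> the exponent of
  \<open>l\<close> is at most 0, which is that of \<open>m2\<close>. Equal total degrees then force
  \<open>l = m2\<close>. The bounds carry over because at each vertex at most one of
  \<open>m1\<close> and \<open>m2\<close> is nonzero.\<close>

lemma nice_mono_glue:
  fixes ends :: "'v set \<Rightarrow> 'v \<times> 'v" and x y :: 'v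
  assumes fin: "finite F1" "finite F2" and disj: "F1 \<inter> F2 = {}"
    and ord: "edge_ordering (F1 \<union> F2) ends" and two: "\<forall>e\<in>F1 \<union> F2. card e = 2"
    and common: "\<Union>F1 \<inter> \<Union>F2 \<subseteq> {x, y}"
    and B: "B1 \<inter> \<Union>F2 \<subseteq> {x, y}" "B2 \<inter> \<Union>F1 \<subseteq> {x, y}" "x \<in> B1" "y \<in> B1" "R \<subseteq> B1"
    and m1: "m1 \<in> Poly_Mapping.keys (Q_poly F1 ends :: ('v, 'f::field) laurent_poly)" "nice_mono R B1 m1"
    and m2: "m2 \<in> Poly_Mapping.keys (Q_poly F2 ends :: ('v, 'f) laurent_poly)" "nice_mono {x, y} B2 m2"
  shows "\<exists>m \<in> Poly_Mapping.keys (Q_poly (F1 \<union> F2) ends :: ('v, 'f) laurent_poly). nice_mono R (B1 \<union> B2) m"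
proof
  let ?l = "Poly_Mapping.lookup"
  have ord12: "edge_ordering F1 ends" "edge_ordering F2 ends"
    using ord by (auto simp: edge_ordering_def)
  have two12: "\<forall>e\<in>F1. card e = 2" "\<forall>e\<in>F2. card e = 2"
    using two by blast+
  note k1 = keys_Q_poly[OF fin(1) ord12(1) two12(1)] and k2 = keys_Q_poly[OF fin(2) ord12(2) two12(2)]
  have fU: "finite (\<Union>F2 \<union> {x, y})"
    using fin(2) two by (auto intro!: finite_Union intro: card_ge_0_finite)
  have uniq: "k = m1"
    if k: "k \<in> Poly_Mapping.keys (Q_poly F1 ends :: ('v, 'f) laurent_poly)"
      and l: "l \<in> Poly_Mapping.keys (Q_poly F2 ends :: ('v, 'f) laurent_poly)"
      and kl: "k + l = m1 + m2" for k l
  proof -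
    have klu: "?l k u + ?l l u = ?l m1 u + ?l m2 u" for u
      using arg_cong[OF kl, of "\<lambda>p. ?l p u"] by (simp add: lookup_add)
    have off: "?l l u = ?l m2 u" if "u \<notin> {x, y}" for u
    proof (cases "u \<in> \<Union>F1")
      case True
      then have "u \<notin> \<Union>F2" using that common by blast
      then show ?thesis using k2(2)[OF l] k2(2)[OF m2(1)] by simp
    next
      case False
      then have "?l k u = 0" "?l m1 u = 0" using k1(2)[OF k] k1(2)[OF m1(1)] by simp_all
      then show ?thesis using klu[of u] by simp
    qed
    have nn: "0 \<le> ?l m2 u - ?l l u" for u
    proof (cases "u \<in> {x, y}")
      case True
      then have "?l m2 u = 0" using m2(2) by (auto simp: nice_mono_def)
      then show ?thesis using k2(1)[OF l, of u] by simp
    qed (simp add: off)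
    have "(\<Sum>u\<in>\<Union>F2 \<union> {x, y}. ?l m2 u - ?l l u) = 0"
      using k2(3)[OF l fU Un_upper1] k2(3)[OF m2(1) fU Un_upper1] unfolding sum_subtractf by simp
    then have on: "\<forall>u\<in>\<Union>F2 \<union> {x, y}. ?l m2 u - ?l l u = 0"
      using nn by (subst (asm) sum_nonneg_eq_0_iff[OF fU]) auto
    have "?l l u = ?l m2 u" for u
      using on off[of u] by (cases "u \<in> {x, y}") auto
    then have "l = m2" by (rule poly_mapping_eqI)
    then show ?thesis using kl by simp
  qed
  have "?l (Q_poly (F1 \<union> F2) ends :: ('v, 'f) laurent_poly) (m1 + m2) = ?l (Q_poly F1 ends) m1 * ?l (Q_poly F2 ends) m2"
    unfolding Q_poly_Un[OF fin disj] using uniq by (rule lookup_mult_unique_pair)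
  then show "m1 + m2 \<in> Poly_Mapping.keys (Q_poly (F1 \<union> F2) ends :: ('v, 'f) laurent_poly)"
    using m1(1) m2(1) by (simp add: in_keys_iff)
  have a: "?l m1 u = 0" if "u \<notin> \<Union>F1" for u using k1(2)[OF m1(1) that] .
  have b: "?l m2 u = 0" if "u \<notin> \<Union>F2 - {x, y}" for u
  proof (cases "u \<in> {x, y}")
    case True
    then show ?thesis using m2(2) by (auto simp: nice_mono_def)
  next
    case False
    then show ?thesis using k2(2)[OF m2(1), of u] that by blast
  qed
  have 0: "?l (m1 + m2) u = ?l m1 u" if "u \<in> B1" for u
    using b[of u] that B(1) by (auto simp: lookup_add)
  have 1: "?l (m1 + m2) u = ?l m1 u \<or> ?l (m1 + m2) u = ?l m2 u" for u
    using a[of u] b[of u] common by (auto simp: lookup_add)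
  \<comment> \<open>At \<open>x\<close> and \<open>y\<close> the exponent comes from
    \<open>m1\<close> alone, so the bound there is inherited from \<open>B1\<close>.\<close>
  have 2: "-2 \<le> ?l (m1 + m2) u" if "u \<in> B2" for u
  proof (cases "u \<in> {x, y}")
    case True
    then have "u \<in> B1" using B(3,4) by blast
    then show ?thesis using 0 m1(2) by (simp add: nice_mono_def)
  next
    case False
    then have "?l m1 u = 0" using a that B(2) by blast
    then show ?thesis using m2(2) that by (simp add: lookup_add nice_mono_def)
  qed
  show "nice_mono R (B1 \<union> B2) (m1 + m2)"
    unfolding nice_mono_def
  proof (intro conjI ballI allI)
    show "?l (m1 + m2) u = 0" if "u \<in> R" for u
    proof -
      have "?l (m1 + m2) u = ?l m1 u" using that B(5) by (intro 0) blast
      then show ?thesis using m1(2) that by (simp add: nice_mono_def)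
    qed
    show "-2 \<le> ?l (m1 + m2) u" if "u \<in> B1 \<union> B2" for u
      using that 0[of u] 2[of u] m1(2) by (auto simp: nice_mono_def)
    show "-4 \<le> ?l (m1 + m2) u" for u
      using 1[of u] m1(2) m2(2) by (auto simp: nice_mono_def)
  qed
qed

text \<open>The exponent of \<open>v\<close> records the number of edges at \<open>v\<close> from which \<open>v\<close> is chosen. Choosing it only
  from the edge to \<open>a\<close> leads to a unique factorisation of the monomial but costs \<open>q\<close> one unit; if no
  monomial of the smaller product can afford this, then choosing \<open>v\<close> from the edges to \<open>a\<close> and \<open>q\<close> also
  leads to a unique factorisation.\<close>

lemma nice_mono_add_star:
  fixes ends :: "'v set \<Rightarrow> 'v \<times> 'v" and v a q b :: 'v and us :: "'v set"
  defines "N \<equiv> insert a (insert q us)"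
  assumes fin: "finite F" "finite us"
    and ord: "edge_ordering (F \<union> star v N) ends" and two: "\<forall>e\<in>F. card e = 2"
    and v: "v \<notin> \<Union>F" "v \<notin> N" and dist: "a \<noteq> q" "a \<notin> us" "q \<notin> us" "a \<noteq> b"
    and B: "us \<inter> B = {}" "a \<in> B" "b \<in> B" "q \<in> B" "v \<in> B" "v \<noteq> b"
    and m': "m' \<in> Poly_Mapping.keys (Q_poly F ends :: ('v, 'f::field) laurent_poly)"
      "nice_mono {a, b} (B - {v} \<union> us) m'"
  shows "\<exists>m \<in> Poly_Mapping.keys (Q_poly (F \<union> star v N) ends :: ('v, 'f) laurent_poly). nice_mono {a, b} B m"
proof -
  let ?l = "Poly_Mapping.lookup"
  let ?Q = "Q_poly F ends :: ('v, 'f) laurent_poly"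
  let ?D = "Q_poly (star v N) ends :: ('v, 'f) laurent_poly"
  have finN: "finite N" using fin by (simp add: N_def)
  have disj: "F \<inter> star v N = {}" using v(1) by (auto simp: star_def)
  have ord': "edge_ordering F ends" "edge_ordering (star v N) ends"
    using ord by (auto simp: edge_ordering_def)
  note Qk = keys_Q_poly[OF fin(1) ord'(1) two]
  note Dk = Q_poly_star[OF finN v(2) ord'(2), where 'f = 'f]
  note lsm = lookup_star_mono[OF finN v(2)]
  \<comment> \<open>Every key of the star product is some \<open>star_mono v N T\<close>, so a
    factorisation is unique as soon as the set \<open>T\<close> is.\<close>
  have step: "m + star_mono v N S \<in> Poly_Mapping.keys (Q_poly (F \<union> star v N) ends :: ('v, 'f) laurent_poly)"
    if m: "m \<in> Poly_Mapping.keys ?Q" and "S \<subseteq> N"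
      and u: "\<And>k T. k \<in> Poly_Mapping.keys ?Q \<Longrightarrow> T \<subseteq> N \<Longrightarrow> k + star_mono v N T = m + star_mono v N S \<Longrightarrow> T = S"
    for m S
  proof -
    have uniq: "k = m" if k: "k \<in> Poly_Mapping.keys ?Q" and l: "l \<in> Poly_Mapping.keys ?D"
      and kl: "k + l = m + star_mono v N S" for k l
    proof -
      obtain T where T: "T \<subseteq> N" "l = star_mono v N T"
        using subsetD[OF Dk(1) l] by (auto elim: imageE)
      then have "T = S" using u k kl by blast
      then show ?thesis using T kl by simp
    qed
    have "?l (Q_poly (F \<union> star v N) ends :: ('v, 'f) laurent_poly) (m + star_mono v N S) = ?l ?Q m * ?l ?D (star_mono v N S)"
      unfolding Q_poly_Un[OF fin(1) finite_star[OF finN] disj] using uniq by (rule lookup_mult_unique_pair)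
    then show ?thesis using m Dk(2)[OF \<open>S \<subseteq> N\<close>] by (simp add: in_keys_iff)
  qed
  have Qv: "?l k v = 0" if "k \<in> Poly_Mapping.keys ?Q" for k
    using Qk(2)[OF that v(1)] .
  \<comment> \<open>\<open>v\<close> lies on no edge of \<open>F\<close>, so its exponent counts the
    star edges from which it is chosen.\<close>
  have cardeq: "card T = card S"
    if "k \<in> Poly_Mapping.keys ?Q" "m \<in> Poly_Mapping.keys ?Q" "k + star_mono v N T = m + star_mono v N S" for k m S T
    using arg_cong[OF that(3), of "\<lambda>p. ?l p v"] Qv[OF that(1)] Qv[OF that(2)] by (simp add: lookup_add lsm)
  \<comment> \<open>The total exponent of \<open>w\<close> is 0. Choosing \<open>w\<close> from its
    star edge would make it negative, and no exponent in \<open>k\<close> is positive to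
    compensate.\<close>
  have inT: "w \<in> T"
    if "k \<in> Poly_Mapping.keys ?Q" "?l m w = 0" "w \<in> S" "w \<in> N" "k + star_mono v N T = m + star_mono v N S" for k m S T w
  proof (rule ccontr)
    assume "w \<notin> T"
    moreover have "w \<noteq> v" using v(2) that by blast
    ultimately show False
      using arg_cong[OF that(5), of "\<lambda>p. ?l p w"] Qk(1)[OF that(1), of w] that(2-4) by (simp add: lookup_add lsm)
  qed
  have va: "v \<noteq> a" "v \<noteq> q" "v \<notin> us" using v(2) by (auto simp: N_def)
  have aN: "a \<in> N" "q \<in> N" "us \<subseteq> N" by (auto simp: N_def)
  have m'0: "?l m' a = 0" "?l m' b = 0" using m'(2) by (auto simp: nice_mono_def)
  have lo: "?l m' x = (if x = v then 0 else ?l m' x)" for x using Qv[OF m'(1)] by simp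
  have bus: "b \<notin> us" using B by blast
  \<comment> \<open>In \<open>m'\<close> the vertices of \<open>us\<close> count as boundary
    vertices, with exponents at least -2. Here they drop to at least -3, which is allowed since they
    lie outside \<open>B\<close>.\<close>
  have nice2: "nice_mono {a, b} B (m' + star_mono v N {a, q})"
    unfolding nice_mono_def
  proof (intro conjI ballI allI)
    have low: "?l m' x \<ge> -2" if "x \<in> B \<union> us" "x \<noteq> v" for x
      using m'(2) that by (auto simp: nice_mono_def)
    have sm: "?l (star_mono v N {a, q}) x = (if x = v then -2 else if x \<in> us then -1 else 0)" for x
      unfolding lsm using dist va by (auto simp: N_def)
    show "?l (m' + star_mono v N {a, q}) x = 0" if "x \<in> {a, b}" for x
      using that m'0 sm B(6) bus dist va by (auto simp: lookup_add)
    show "-2 \<le> ?l (m' + star_mono v N {a, q}) x" if "x \<in> B" for x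
      using that low[of x] B(1) Qv[OF m'(1)] by (auto simp: lookup_add sm)
    show "-4 \<le> ?l (m' + star_mono v N {a, q}) x" for x
    proof -
      have "-2 \<le> ?l m' x" if "x \<in> us" using that m'(2) va by (simp add: nice_mono_def)
      moreover have "-4 \<le> ?l m' x" using m'(2) by (simp add: nice_mono_def)
      ultimately show ?thesis using Qv[OF m'(1)] by (auto simp: lookup_add sm)
    qed
  qed
  show ?thesis
  proof (cases "q = b")
    \<comment> \<open>Both \<open>a\<close> and \<open>q = b\<close> have exponent 0 in
      \<open>m'\<close>, so \<open>T\<close> must contain them, and its size leaves room for nothing
      else.\<close>
    case True
    have "m' + star_mono v N {a, q} \<in> Poly_Mapping.keys (Q_poly (F \<union> star v N) ends :: ('v, 'f) laurent_poly)"
    proof (rule step[OF m'(1)])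
      fix k T assume T: "k \<in> Poly_Mapping.keys ?Q" "T \<subseteq> N" "k + star_mono v N T = m' + star_mono v N {a, q}"
      have "card T = 2" using cardeq[OF T(1) m'(1) T(3)] dist by simp
      moreover have "{a, q} \<subseteq> T"
        using inT[OF T(1) _ _ _ T(3), of a] inT[OF T(1) _ _ _ T(3), of q] m'0 aN True by simp
      moreover have "finite T" using T(2) finN finite_subset by blast
      ultimately show "T = {a, q}" using dist by (metis card_2_iff card_subset_eq)
    qed (use aN in simp)
    then show ?thesis using nice2 by blast
  next
    case qb: False
    \<comment> \<open>These bounds are what is needed to afford one more factor at \<open>q\<close>
      and at each vertex of \<open>us\<close>, the price of choosing \<open>v\<close> only from the
      edge to \<open>a\<close>.\<close>
    define light where "light k \<longleftrightarrow> k \<in> Poly_Mapping.keys ?Q \<and> ?l k a = 0 \<and> ?l k b = 0 \<and>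
      (\<forall>x\<in>B. -2 \<le> ?l k x) \<and> -1 \<le> ?l k q \<and> (\<forall>x\<in>us. -3 \<le> ?l k x) \<and> (\<forall>x. -4 \<le> ?l k x)" for k
    show ?thesis
    proof (cases "\<exists>k. light k")
      case True
      then obtain m where m: "light m" by blast
      then have mk: "m \<in> Poly_Mapping.keys ?Q" "?l m a = 0" by (auto simp: light_def)
      have "m + star_mono v N {a} \<in> Poly_Mapping.keys (Q_poly (F \<union> star v N) ends :: ('v, 'f) laurent_poly)"
      proof (rule step[OF mk(1)])
        fix k T assume T: "k \<in> Poly_Mapping.keys ?Q" "T \<subseteq> N" "k + star_mono v N T = m + star_mono v N {a}"
        have "card T = 1" using cardeq[OF T(1) mk(1) T(3)] by simp
        moreover have "a \<in> T" using inT[OF T(1) _ _ _ T(3), of a] mk aN by simp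
        ultimately show "T = {a}" by (auto simp: card_1_singleton_iff)
      qed (use aN in simp)
      moreover have "nice_mono {a, b} B (m + star_mono v N {a})"
        unfolding nice_mono_def
      proof (intro conjI ballI allI)
        have sm: "?l (star_mono v N {a}) x = (if x = v \<or> x = q \<or> x \<in> us then -1 else 0)" for x
          unfolding lsm using dist va by (auto simp: N_def)
        show "?l (m + star_mono v N {a}) x = 0" if "x \<in> {a, b}" for x
          using that m sm B(6) bus dist va qb by (auto simp: lookup_add light_def)
        show "-2 \<le> ?l (m + star_mono v N {a}) x" if "x \<in> B" for x
          using that m B(1) Qv[OF mk(1)] by (auto simp: lookup_add sm light_def)
        show "-4 \<le> ?l (m + star_mono v N {a}) x" for x
        proof -
          have "?l m x \<ge> -3" if "x = v \<or> x = q \<or> x \<in> us"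
            using that m Qv[OF mk(1)] by (auto simp: light_def)
          then show ?thesis using m by (auto simp: lookup_add sm light_def)
        qed
      qed
      ultimately show ?thesis by blast
    next
      case False
      have "m' + star_mono v N {a, q} \<in> Poly_Mapping.keys (Q_poly (F \<union> star v N) ends :: ('v, 'f) laurent_poly)"
      proof (rule step[OF m'(1)])
        fix k T assume T: "k \<in> Poly_Mapping.keys ?Q" "T \<subseteq> N" "k + star_mono v N T = m' + star_mono v N {a, q}"
        have "card T = 2" using cardeq[OF T(1) m'(1) T(3)] dist by simp
        moreover have "a \<in> T"
          using inT[OF T(1) _ _ _ T(3), of a] m'0 aN by simp
        ultimately obtain w where w: "T = {a, w}" "w \<noteq> a"
          by (auto simp: card_2_iff doubleton_eq_iff)
        have "w = q"
        proof (rule ccontr)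
          assume "w \<noteq> q"
          then have wus: "w \<in> us" using w T(2) by (auto simp: N_def)
          \<comment> \<open>Comparing the two star monomials shows that \<open>k\<close> trades one
            factor 1/q of \<open>m'\<close> for a factor 1/w. This leaves \<open>q\<close> with at
            least -1 and \<open>w\<close> with at least -3, so \<open>k\<close> is light, a
            contradiction.\<close>
          have k: "?l k x = ?l m' x + (if x = q then 1 else 0) - (if x = w then 1 else 0)" for x
            using arg_cong[OF T(3), of "\<lambda>p. ?l p x"] w wus dist va \<open>w \<noteq> q\<close>
            unfolding lookup_add lsm by (auto simp: N_def split: if_splits)
          have low: "?l m' x \<ge> -2" if "x \<in> B \<union> us" for x
            using m'(2) that Qv[OF m'(1)] by (cases "x = v") (auto simp: nice_mono_def)
          have wB: "w \<notin> B" "w \<noteq> a" "w \<noteq> b" using wus B by auto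
          have "light k"
            unfolding light_def
          proof (intro conjI ballI allI)
            show "k \<in> Poly_Mapping.keys ?Q" by fact
            show "?l k a = 0" "?l k b = 0" using k m'0 wB dist qb by auto
            show "-2 \<le> ?l k x" if "x \<in> B" for x using that k[of x] low[of x] wB by auto
            show "-1 \<le> ?l k q" using k[of q] low[of q] \<open>w \<noteq> q\<close> B(4) by auto
            show "-3 \<le> ?l k x" if "x \<in> us" for x using that k[of x] low[of x] by auto
            show "-4 \<le> ?l k x" for x
            proof -
              have "-4 \<le> ?l m' x" using m'(2) by (simp add: nice_mono_def)
              moreover have "-2 \<le> ?l m' w" using low wus by blast
              ultimately show ?thesis using k[of x] by auto
            qed
          qed
          then show False using False by blast
        qed
        then show "T = {a, q}" using w by simp
      qed (use aN in simp)
      then show ?thesis using nice2 by blast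
    qed
  qed
qed

text \<open>The base case: a triangle without its root edge \<open>aq\<close>. Choosing
  \<open>v\<close> from both remaining edges puts the whole degree on \<open>v\<close>.\<close>

lemma nice_mono_path:
  fixes ends :: "'v set \<Rightarrow> 'v \<times> 'v" and v a q :: 'v
  assumes ord: "edge_ordering (star v {a, q}) ends" and "v \<noteq> a" "v \<noteq> q" "a \<noteq> q"
  shows "\<exists>m \<in> Poly_Mapping.keys (Q_poly (star v {a, q}) ends :: ('v, 'f::field) laurent_poly). nice_mono {a, q} {a, v, q} m"
proof
  show "star_mono v {a, q} {a, q} \<in> Poly_Mapping.keys (Q_poly (star v {a, q}) ends :: ('v, 'f) laurent_poly)"
    using Q_poly_star(2)[OF _ _ ord, of "{a, q}", where 'f = 'f] assms by (simp add: in_keys_iff)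
  show "nice_mono {a, q} {a, v, q} (star_mono v {a, q} {a, q})"
    using assms by (simp add: nice_mono_def lookup_star_mono)
qed

section \<open>Cycles of a plane graph\<close>

lemma connected_subset_inside:
  fixes S T :: "'a::real_normed_vector set"
  assumes "connected T" "T \<inter> S = {}" "closed S" "T \<inter> inside S \<noteq> {}"
  shows "T \<subseteq> inside S"
  using connected_Int_frontier[OF assms(1,4)] frontier_inside_subset[OF assms(3)] assms(2) by blast

text \<open>Connectedness puts \<open>S\<close> on one side of the curve. If it were not the whole
  side, that side, being connected, would meet the frontier of \<open>S\<close>, which is the curve
  itself. Boundedness selects the side.\<close>

lemma connected_eq_inside_or_outside:
  fixes g :: "real \<Rightarrow> complex"
  assumes "simple_path g" "pathfinish g = pathstart g"
    and "connected S" "S \<noteq> {}" "frontier S = path_image g" "S \<inter> path_image g = {}"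
  shows "bounded S \<Longrightarrow> S = inside (path_image g)"
    and "\<not> bounded S \<Longrightarrow> S = outside (path_image g)"
proof -
  note J = Jordan_inside_outside[OF assms(1,2)]
  have cover: "S \<subseteq> inside (path_image g) \<union> outside (path_image g)"
    using assms(6) by auto
  have sub: "S \<subseteq> inside (path_image g) \<or> S \<subseteq> outside (path_image g)"
    using connectedD[OF assms(3), of "inside (path_image g)" "outside (path_image g)"] cover J by blast
  have eq: "S = T" if "S \<subseteq> T" "connected T" "T \<inter> path_image g = {}" for T
  proof (rule ccontr)
    assume "S \<noteq> T"
    then have "T \<inter> frontier S \<noteq> {}"
      using that assms(4) by (intro connected_Int_frontier) auto
    then show False using that(3) assms(5) by simp
  qed
  have "S = inside (path_image g) \<or> S = outside (path_image g)"
    using sub eq J inside_no_overlap outside_no_overlap by metis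
  then show "bounded S \<Longrightarrow> S = inside (path_image g)" "\<not> bounded S \<Longrightarrow> S = outside (path_image g)"
    using J by auto
qed

section \<open>Walks and cycles as vertex lists\<close>

fun walk_edges :: "'v list \<Rightarrow> 'v set set" where
  "walk_edges (x # y # zs) = insert {x, y} (walk_edges (y # zs))"
| "walk_edges _ = {}"

lemma walk_edges_append: "walk_edges (xs @ x # ys) = walk_edges (xs @ [x]) \<union> walk_edges (x # ys)"
proof (induction xs)
  case (Cons a xs)
  then show ?case by (cases xs) auto
qed simp

lemma Union_walk_edges_subset: "\<Union>(walk_edges xs) \<subseteq> set xs"
  by (induction xs rule: walk_edges.induct) auto

lemma Union_walk_edges: "2 \<le> length xs \<Longrightarrow> \<Union>(walk_edges xs) = set xs"
proof (induction xs rule: walk_edges.induct)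
  case (1 x y zs)
  then show ?case by (cases zs) auto
qed auto

lemma walk_edges_conv_nth: "walk_edges xs = {{xs ! i, xs ! Suc i} | i. Suc i < length xs}"
proof (induction xs rule: walk_edges.induct)
  case (1 x y zs)
  have "{{(x # y # zs) ! i, (x # y # zs) ! Suc i} | i. Suc i < length (x # y # zs)} =
    insert {x, y} {{(y # zs) ! i, (y # zs) ! Suc i} | i. Suc i < length (y # zs)}" (is "?L = insert _ ?R")
  proof (intro set_eqI iffI)
    fix e assume "e \<in> ?L"
    then obtain i where "e = {(x # y # zs) ! i, (x # y # zs) ! Suc i}" "Suc i < length (x # y # zs)" by blast
    then show "e \<in> insert {x, y} ?R" by (cases i) auto
  next
    fix e assume "e \<in> insert {x, y} ?R"
    then show "e \<in> ?L"
    proof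
      assume "e = {x, y}"
      then show ?thesis by (auto intro!: exI[of _ 0])
    next
      assume "e \<in> ?R"
      then obtain i where "e = {(y # zs) ! i, (y # zs) ! Suc i}" "Suc i < length (y # zs)" by blast
      then show ?thesis by (auto intro!: exI[of _ "Suc i"])
    qed
  qed
  then show ?case using 1 by simp
qed auto

lemma cycle_edges_conv_walk:
  assumes "c \<noteq> []"
  shows "cycle_edges c = walk_edges (c @ [hd c])"
proof -
  have "{c ! i, c ! (Suc i mod length c)} = {(c @ [hd c]) ! i, (c @ [hd c]) ! Suc i}" if "i < length c" for i
  proof (cases "Suc i = length c")
    case True
    then show ?thesis using that assms by (simp add: nth_append hd_conv_nth)
  next
    case False
    then show ?thesis using that by (simp add: nth_append)
  qed
  then show ?thesis
    unfolding cycle_edges_def walk_edges_conv_nth by auto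
qed

text \<open>Two vertices cut a cycle into two walks. The second one wraps around the end of the
  list, so the place where the list starts is immaterial.\<close>

lemma cycle_edges_split:
  "cycle_edges (xs @ x # ys @ y # zs) = walk_edges (x # ys @ [y]) \<union> walk_edges (y # zs @ xs @ [x])"
proof (cases xs)
  case Nil
  then show ?thesis
    using walk_edges_append[of "x # ys" y "zs @ [x]"] by (simp add: cycle_edges_conv_walk)
next
  case (Cons k ks)
  have "cycle_edges (xs @ x # ys @ y # zs) = walk_edges ((k # ks) @ x # ys @ y # zs @ [k])"
    by (simp add: Cons cycle_edges_conv_walk)
  also have "\<dots> = walk_edges (k # ks @ [x]) \<union> walk_edges (x # ys @ y # zs @ [k])"
    by (subst walk_edges_append) simp
  also have "walk_edges (x # ys @ y # zs @ [k]) = walk_edges (x # ys @ [y]) \<union> walk_edges (y # zs @ [k])"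
    using walk_edges_append[of "x # ys" y "zs @ [k]"] by simp
  finally show ?thesis
    using walk_edges_append[of "y # zs" k "ks @ [x]"] Cons by auto
qed

lemma walk_edges_rev: "walk_edges (rev xs) = walk_edges xs"
proof (induction xs rule: walk_edges.induct)
  case (1 x y zs)
  have "walk_edges (rev zs @ y # [x]) = walk_edges (rev zs @ [y]) \<union> walk_edges [y, x]"
    by (rule walk_edges_append)
  then show ?case using 1 by (auto simp: insert_commute)
qed auto

text \<open>On a walk without repetitions \<open>x\<close> occurs only in the first edge and
  \<open>y\<close> only in the last. This serves to tell chords from cycle edges.\<close>

lemma doubleton_in_walk_edges:
  "distinct (x # as @ [y]) \<Longrightarrow> {x, y} \<in> walk_edges (x # as @ [y]) \<Longrightarrow> as = []"
  using Union_walk_edges_subset by (cases as) (fastforce simp: doubleton_eq_iff)+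

section \<open>Edges enclosed by a cycle of the drawing\<close>

context plane_graph
begin

definition img :: "'v set set \<Rightarrow> complex set" where
  "img K = (\<Union>e\<in>K. path_image (\<gamma> e))"

text \<open>An edge is located by a single inner point of its arc, which lies on no other edge.\<close>

definition mid :: "'v set \<Rightarrow> complex" where
  "mid e = \<gamma> e (1/2)"

definition enclosed :: "'v set set \<Rightarrow> 'v set set" where
  "enclosed K = {e \<in> E. mid e \<in> img K \<union> inside (img K)}"

lemma finite_edges: "finite E"
  using finite_verts simple_edges by (meson PowI finite_Pow_iff finite_subset subsetI)

lemma img_Un: "img (K \<union> L) = img K \<union> img L"
  by (auto simp: img_def)

lemma img_subset_drawing: "K \<subseteq> E \<Longrightarrow> img K \<subseteq> drawing"
  by (auto simp: img_def drawing_def)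

lemma compact_img: "K \<subseteq> E \<Longrightarrow> compact (img K)"
  unfolding img_def using finite_edges edge_arc
  by (intro compact_UN) (auto intro: compact_arc_image finite_subset)

lemma closed_img: "K \<subseteq> E \<Longrightarrow> closed (img K)"
  by (simp add: compact_img compact_imp_closed)

lemma compact_drawing: "compact drawing"
  using compact_img[of E] finite_verts
  by (simp add: drawing_def img_def compact_Un finite_imp_compact)

lemma mid_in_path_image: "mid e \<in> path_image (\<gamma> e)"
  by (simp add: mid_def path_image_def)

lemma mid_notin_verts:
  assumes "e \<in> E"
  shows "mid e \<notin> pos ` V"
proof
  assume "mid e \<in> pos ` V"
  then have "mid e \<in> {pathstart (\<gamma> e), pathfinish (\<gamma> e)}"
    using edge_avoids_verts[OF assms] edge_ends[OF assms] mid_in_path_image by blast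
  then consider "\<gamma> e (1/2) = \<gamma> e 0" | "\<gamma> e (1/2) = \<gamma> e 1"
    by (auto simp: mid_def pathstart_def pathfinish_def)
  moreover have "inj_on (\<gamma> e) {0..1}"
    using edge_arc[OF assms] by (simp add: arc_def)
  ultimately show False
    by cases (auto dest: inj_onD[where x = "1/2"])
qed

lemma edge_point_in_img:
  assumes "e \<in> E" "K \<subseteq> E" "z \<in> path_image (\<gamma> e)" "z \<notin> pos ` V"
  shows "z \<in> img K \<longleftrightarrow> e \<in> K"
proof
  assume "z \<in> img K"
  then obtain f where f: "f \<in> K" "z \<in> path_image (\<gamma> f)" by (auto simp: img_def)
  show "e \<in> K"
  proof (rule ccontr)
    assume "e \<notin> K"
    then have "z \<in> pos ` (e \<inter> f)"
      using edges_noncrossing[of e f] f assms by blast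
    then show False using assms simple_edges by blast
  qed
qed (use assms in \<open>auto simp: img_def\<close>)

lemma mid_in_img_iff: "e \<in> E \<Longrightarrow> K \<subseteq> E \<Longrightarrow> mid e \<in> img K \<longleftrightarrow> e \<in> K"
  by (simp add: edge_point_in_img mid_in_path_image mid_notin_verts)

lemma vertex_in_img_iff:
  assumes "K \<subseteq> E" "u \<in> V"
  shows "pos u \<in> img K \<longleftrightarrow> u \<in> \<Union>K"
proof
  assume "pos u \<in> img K"
  then obtain f where f: "f \<in> K" "pos u \<in> path_image (\<gamma> f)" by (auto simp: img_def)
  then have "pos u \<in> pos ` f" using edge_avoids_verts[of f] assms by blast
  then have "u \<in> f"
    using pos_inj assms f simple_edges[of f] by (auto simp: inj_on_def)
  then show "u \<in> \<Union>K" using f by blast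
next
  assume "u \<in> \<Union>K"
  then obtain f where "f \<in> K" "u \<in> f" by blast
  then show "pos u \<in> img K"
    using edge_avoids_verts[of f] assms by (auto simp: img_def)
qed

lemma enclosed_conv: "K \<subseteq> E \<Longrightarrow> enclosed K = K \<union> {e \<in> E. mid e \<in> inside (img K)}"
  unfolding enclosed_def using mid_in_img_iff by blast

text \<open>The arc of an edge outside \<open>K\<close>, stripped of its ends, is connected and
  misses \<open>img K\<close>, so it lies on the side of its midpoint; the ends follow by closure.
  This justifies locating an edge by one point.\<close>

lemma enclosed_path_image:
  assumes K: "K \<subseteq> E" and e: "e \<in> enclosed K"
  shows "path_image (\<gamma> e) \<subseteq> img K \<union> inside (img K)"
proof (cases "e \<in> K")
  case True
  then show ?thesis by (auto simp: img_def)
next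
  case False
  have eE: "e \<in> E" and mi: "mid e \<in> inside (img K)"
    using e False K by (auto simp: enclosed_conv)
  define T where "T = path_image (\<gamma> e) - {pathstart (\<gamma> e), pathfinish (\<gamma> e)}"
  have arc: "arc (\<gamma> e)" using eE edge_arc by blast
  have T: "T = path_image (\<gamma> e) - pos ` V"
    using edge_ends[OF eE] edge_avoids_verts[OF eE] by (auto simp: T_def)
  have "connected T"
    unfolding T_def using arc by (intro connected_simple_path_endless arc_imp_simple_path)
  moreover have "T \<inter> img K = {}"
    using edge_point_in_img[OF eE K] False by (auto simp: T)
  moreover have "mid e \<in> T" by (simp add: T mid_in_path_image mid_notin_verts eE)
  ultimately have "T \<subseteq> inside (img K)"
    using mi by (intro connected_subset_inside closed_img K) auto
  then have "closure T \<subseteq> img K \<union> inside (img K)"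
    using closure_inside_subset[OF closed_img[OF K]] closure_mono by blast
  moreover have "path_image (\<gamma> e) \<subseteq> closure T"
  proof -
    have "T = \<gamma> e ` {0<..<1}"
      unfolding T_def by (intro simple_path_endless arc_imp_simple_path arc)
    then have "\<gamma> e ` closure {0<..<1} \<subseteq> closure T"
      using arc by (intro image_closure_subset) (auto simp: arc_def path_def intro: closure_subset[THEN subsetD])
    then show ?thesis by (simp add: path_image_def)
  qed
  ultimately show ?thesis by simp
qed

lemma enclosed_vertex:
  assumes "K \<subseteq> E" "u \<in> \<Union>(enclosed K)"
  shows "pos u \<in> img K \<union> inside (img K)"
proof -
  obtain e where e: "e \<in> enclosed K" "u \<in> e" using assms by blast
  then have "e \<in> E" by (simp add: enclosed_def)
  then have "pos u \<in> path_image (\<gamma> e)"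
    using e edge_avoids_verts by blast
  then show ?thesis using enclosed_path_image[OF assms(1) e(1)] by blast
qed

text \<open>The arcs of the edges are joined one after the other, reversed where their direction
  does not fit. As vertices are distinct and edges do not cross, an arc meets the rest of the walk
  only at the joint.\<close>

lemma walk_arc:
  assumes "distinct xs" "2 \<le> length xs" "walk_edges xs \<subseteq> E"
  shows "\<exists>g. arc g \<and> pathstart g = pos (hd xs) \<and> pathfinish g = pos (last xs) \<and> path_image g = img (walk_edges xs)"
  using assms
proof (induction xs rule: walk_edges.induct)
  case (1 x y zs)
  have xy: "{x, y} \<in> E" using 1 by simp
  then have arc: "arc (\<gamma> {x, y})" and ends: "{pathstart (\<gamma> {x, y}), pathfinish (\<gamma> {x, y})} = {pos x, pos y}"
    using edge_arc edge_ends[OF xy] by auto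
  obtain h where h: "arc h" "pathstart h = pos x" "pathfinish h = pos y" "path_image h = path_image (\<gamma> {x, y})"
  proof (cases "pathstart (\<gamma> {x, y}) = pos x")
    case True
    then have "pathfinish (\<gamma> {x, y}) = pos y" using ends by (auto simp: doubleton_eq_iff)
    then show ?thesis using that arc True by blast
  next
    case False
    then have "pathfinish (\<gamma> {x, y}) = pos x" "pathstart (\<gamma> {x, y}) = pos y"
      using ends by (auto simp: doubleton_eq_iff)
    then show ?thesis
      using that[of "reversepath (\<gamma> {x, y})"] arc by (simp add: arc_reversepath)
  qed
  show ?case
  proof (cases zs)
    case Nil
    then show ?thesis using h by (auto simp: img_def)
  next
    case (Cons z zs')
    obtain g where g: "arc g" "pathstart g = pos y" "pathfinish g = pos (last (y # zs))"
      "path_image g = img (walk_edges (y # zs))"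
      using 1 Cons by auto
    have "path_image h \<inter> path_image g \<subseteq> {pos y}"
    proof
      fix p assume "p \<in> path_image h \<inter> path_image g"
      then obtain f where f: "f \<in> walk_edges (y # zs)" "p \<in> path_image (\<gamma> f)" "p \<in> path_image (\<gamma> {x, y})"
        using h g by (auto simp: img_def)
      have "x \<notin> f" using f Union_walk_edges_subset[of "y # zs"] 1(2) by auto
      then have "p \<in> pos ` ({x, y} \<inter> f)" "{x, y} \<inter> f \<subseteq> {y}"
        using edges_noncrossing[OF xy, of f] f 1(4) by auto
      then show "p \<in> {pos y}" by blast
    qed
    then have "arc (h +++ g)" using h g by (intro arc_join) auto
    then show ?thesis
      using h g by (intro exI[of _ "h +++ g"]) (auto simp: path_image_join img_def)
  qed
qed auto

text \<open>The first edge is one arc and the walk back another. With at least three vertices that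
  edge does not recur on the walk, so the arcs meet only in their common ends.\<close>

lemma cycle_simple_path:
  assumes "is_cycle E c"
  shows "\<exists>g. simple_path g \<and> pathfinish g = pathstart g \<and> path_image g = img (cycle_edges c)"
proof -
  obtain x y ys where c: "c = x # y # ys" and "ys \<noteq> []"
    using assms unfolding is_cycle_def by (metis Suc_le_length_iff eval_nat_numeral(3) list.distinct(1) numeral_2_eq_2)
  have dist: "distinct c" and sub: "cycle_edges c \<subseteq> E" using assms by (auto simp: is_cycle_def)
  have ce: "cycle_edges c = walk_edges [x, y] \<union> walk_edges (y # ys @ [x])"
    using cycle_edges_split[of "[]" x "[]" y ys] c by simp
  obtain g where g: "arc g" "pathstart g = pos x" "pathfinish g = pos y" "path_image g = img (walk_edges [x, y])"
    using walk_arc[of "[x, y]"] dist sub ce c by auto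
  obtain h where h: "arc h" "pathstart h = pos y" "pathfinish h = pos x" "path_image h = img (walk_edges (y # ys @ [x]))"
    using walk_arc[of "y # ys @ [x]"] dist sub ce c by auto
  have nin: "{x, y} \<notin> walk_edges (y # ys @ [x])"
    using doubleton_in_walk_edges[of y ys x] dist \<open>ys \<noteq> []\<close> by (auto simp: c insert_commute)
  have "path_image g \<inter> path_image h \<subseteq> {pos x, pos y}"
  proof
    fix p assume "p \<in> path_image g \<inter> path_image h"
    then obtain f where f: "f \<in> walk_edges (y # ys @ [x])" "p \<in> path_image (\<gamma> f)" "p \<in> path_image (\<gamma> {x, y})"
      using h g by (auto simp: img_def)
    then have "p \<in> pos ` ({x, y} \<inter> f)"
      using edges_noncrossing[of "{x, y}" f] nin sub ce by auto
    then show "p \<in> {pos x, pos y}" by blast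
  qed
  then have "simple_path (g +++ h)"
    using g h by (intro simple_path_join_loop) auto
  then show ?thesis
    using g h by (intro exI[of _ "g +++ h"]) (simp add: path_image_join ce img_Un del: walk_edges.simps)
qed

lemma walks_meet:
  assumes "walk_edges (x # as @ [y]) \<subseteq> E" "walk_edges (x # bs @ [y]) \<subseteq> E"
    and "walk_edges (x # as @ [y]) \<inter> walk_edges (x # bs @ [y]) = {}" "set as \<inter> set bs = {}"
    and "distinct (x # as @ [y])" "distinct (x # bs @ [y])"
  shows "img (walk_edges (x # as @ [y])) \<inter> img (walk_edges (x # bs @ [y])) = {pos x, pos y}"
proof
  show "img (walk_edges (x # as @ [y])) \<inter> img (walk_edges (x # bs @ [y])) \<subseteq> {pos x, pos y}"
  proof
    fix p assume "p \<in> img (walk_edges (x # as @ [y])) \<inter> img (walk_edges (x # bs @ [y]))"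
    then obtain e f where ef: "e \<in> walk_edges (x # as @ [y])" "f \<in> walk_edges (x # bs @ [y])"
      "p \<in> path_image (\<gamma> e)" "p \<in> path_image (\<gamma> f)" by (auto simp: img_def)
    then have "p \<in> pos ` (e \<inter> f)"
      using edges_noncrossing[of e f] assms(1-3) by blast
    moreover have "e \<inter> f \<subseteq> {x, y}"
      using ef Union_walk_edges_subset[of "x # as @ [y]"] Union_walk_edges_subset[of "x # bs @ [y]"] assms(4-6) by auto
    ultimately show "p \<in> {pos x, pos y}" by blast
  qed
  have "pos u \<in> img (walk_edges (x # cs @ [y]))" if "u \<in> {x, y}" "walk_edges (x # cs @ [y]) \<subseteq> E" for u cs
  proof -
    have "u \<in> \<Union>(walk_edges (x # cs @ [y]))" using that Union_walk_edges[of "x # cs @ [y]"] by auto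
    then show ?thesis using that(2) simple_edges vertex_in_img_iff by blast
  qed
  then show "{pos x, pos y} \<subseteq> img (walk_edges (x # as @ [y])) \<inter> img (walk_edges (x # bs @ [y]))"
    using assms(1,2) by blast
qed

text \<open>\<open>A\<close>, \<open>B\<close> and \<open>P\<close> are the three paths of a theta
  graph, with \<open>P\<close> running through the inside of \<open>A \<union> B\<close>. The
  geometric input is \<open>split_inside_simple_closed_curve\<close>; midpoints translate it to
  edges and positions translate it to vertices.\<close>

lemma theta_split:
  fixes as bs ps x y
  defines "A \<equiv> walk_edges (x # as @ [y])" and "B \<equiv> walk_edges (x # bs @ [y])" and "P \<equiv> walk_edges (x # ps @ [y])"
  assumes dist: "distinct (x # as @ [y])" "distinct (x # bs @ [y])" "distinct (x # ps @ [y])"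
    and sets: "set as \<inter> set bs = {}" "set as \<inter> set ps = {}" "set bs \<inter> set ps = {}"
    and sub: "A \<subseteq> E" "B \<subseteq> E" "P \<subseteq> E"
    and edges: "A \<inter> B = {}" "A \<inter> P = {}" "B \<inter> P = {}"
    and ne: "img P \<inter> inside (img (A \<union> B)) \<noteq> {}"
  shows "enclosed (A \<union> B) = enclosed (A \<union> P) \<union> enclosed (B \<union> P)"
    and "enclosed (A \<union> P) \<inter> enclosed (B \<union> P) = P"
    and "\<Union>(enclosed (A \<union> P)) \<inter> \<Union>(enclosed (B \<union> P)) \<subseteq> insert x (insert y (set ps))"
proof -
  obtain g where g: "arc g" "pathstart g = pos x" "pathfinish g = pos y" "path_image g = img A"
    using walk_arc[OF dist(1)] sub(1) by (auto simp: A_def)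
  obtain h where h: "arc h" "pathstart h = pos x" "pathfinish h = pos y" "path_image h = img B"
    using walk_arc[OF dist(2)] sub(2) by (auto simp: B_def)
  obtain k where k: "arc k" "pathstart k = pos x" "pathfinish k = pos y" "path_image k = img P"
    using walk_arc[OF dist(3)] sub(3) by (auto simp: P_def)
  have AB: "img A \<inter> img B = {pos x, pos y}"
    unfolding A_def B_def using assms by (intro walks_meet) auto
  have AP: "img A \<inter> img P = {pos x, pos y}"
    unfolding A_def P_def using assms by (intro walks_meet) auto
  have BP: "img B \<inter> img P = {pos x, pos y}"
    unfolding B_def P_def using assms by (intro walks_meet) auto
  have "pos x \<noteq> pos y"
    using g arc_distinct_ends by metis
  then obtain in0: "inside (img (A \<union> P)) \<inter> inside (img (B \<union> P)) = {}"
    and inU: "inside (img (A \<union> P)) \<union> inside (img (B \<union> P)) \<union> (img P - {pos x, pos y}) = inside (img (A \<union> B))"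
    using split_inside_simple_closed_curve[of g "pos x" "pos y" h k] g h k AB AP BP ne
    by (auto simp: img_Un arc_imp_simple_path)
  have sub_in: "inside (img (A \<union> P)) \<subseteq> inside (img (A \<union> B))" "inside (img (B \<union> P)) \<subseteq> inside (img (A \<union> B))"
    using inU by blast+
  have AiBP: "img A \<inter> inside (img (B \<union> P)) = {}"
    using sub_in inside_no_overlap[of "img (A \<union> B)"] unfolding img_Un by blast
  have BiAP: "img B \<inter> inside (img (A \<union> P)) = {}"
    using sub_in inside_no_overlap[of "img (A \<union> B)"] unfolding img_Un by blast
  \<comment> \<open>Neither outer path enters the opposite half, so the two closed regions share
    only the dividing path. Both intersection statements rest on this.\<close>
  have common: "(img (A \<union> P) \<union> inside (img (A \<union> P))) \<inter> (img (B \<union> P) \<union> inside (img (B \<union> P))) \<subseteq> img P"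
    using in0 AiBP BiAP AB AP inside_no_overlap[of "img (A \<union> P)"] inside_no_overlap[of "img (B \<union> P)"]
    unfolding img_Un by blast
  have union: "img (A \<union> B) \<union> inside (img (A \<union> B)) =
    (img (A \<union> P) \<union> inside (img (A \<union> P))) \<union> (img (B \<union> P) \<union> inside (img (B \<union> P)))"
    using inU AP unfolding img_Un by blast
  show "enclosed (A \<union> B) = enclosed (A \<union> P) \<union> enclosed (B \<union> P)"
    unfolding enclosed_def union by blast
  show "enclosed (A \<union> P) \<inter> enclosed (B \<union> P) = P"
  proof
    show "enclosed (A \<union> P) \<inter> enclosed (B \<union> P) \<subseteq> P"
      using common mid_in_img_iff[OF _ sub(3)] by (auto simp: enclosed_def)
    show "P \<subseteq> enclosed (A \<union> P) \<inter> enclosed (B \<union> P)"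
      using sub by (auto simp: enclosed_conv)
  qed
  show "\<Union>(enclosed (A \<union> P)) \<inter> \<Union>(enclosed (B \<union> P)) \<subseteq> insert x (insert y (set ps))"
  proof
    fix u assume u: "u \<in> \<Union>(enclosed (A \<union> P)) \<inter> \<Union>(enclosed (B \<union> P))"
    then have "u \<in> V" using simple_edges by (auto simp: enclosed_def)
    have "pos u \<in> img P"
      using common u enclosed_vertex[of "A \<union> P" u] enclosed_vertex[of "B \<union> P" u] sub by blast
    then have "u \<in> \<Union>P" using vertex_in_img_iff[OF sub(3) \<open>u \<in> V\<close>] by blast
    then show "u \<in> insert x (insert y (set ps))"
      using Union_walk_edges_subset[of "x # ps @ [y]"] by (auto simp: P_def)
  qed
qed

end

lemma Union_cycle_edges:
  assumes "2 \<le> length c"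
  shows "\<Union>(cycle_edges c) = set c"
proof -
  have "c \<noteq> []" using assms by auto
  then show ?thesis
    using assms Union_walk_edges[of "c @ [hd c]"] by (auto simp: cycle_edges_conv_walk)
qed

lemma cycle_edges_append_commute: "cycle_edges (xs @ ys) = cycle_edges (ys @ xs)"
proof (cases "xs = [] \<or> ys = []")
  case False
  then obtain x xs' y ys' where "xs = x # xs'" "ys = y # ys'" by (meson neq_Nil_conv)
  then show ?thesis
    using cycle_edges_split[of "[]" x xs' y ys'] cycle_edges_split[of "[]" y ys' x xs'] by auto
qed auto

text \<open>This closing edge of the list is the one that serves as root edge in the
  induction.\<close>

lemma hd_last_in_cycle_edges:
  assumes "c \<noteq> []"
  shows "{hd c, last c} \<in> cycle_edges c"
proof -
  have "c @ [hd c] = butlast c @ last c # [hd c]" using assms by simp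
  then have "cycle_edges c = walk_edges (butlast c @ last c # [hd c])"
    using cycle_edges_conv_walk[OF assms] by (simp only:)
  also have "\<dots> = walk_edges (butlast c @ [last c]) \<union> walk_edges [last c, hd c]"
    by (rule walk_edges_append)
  finally show ?thesis by (simp add: insert_commute)
qed

section \<open>Cutting a cycle along a chord or a triangle\<close>

context plane_graph
begin

lemma enclosed_subset: "enclosed K \<subseteq> E"
  by (auto simp: enclosed_def)

lemma finite_enclosed: "finite (enclosed K)"
  using finite_subset[OF enclosed_subset finite_edges] .

lemma subset_enclosed: "K \<subseteq> E \<Longrightarrow> K \<subseteq> enclosed K"
  by (auto simp: enclosed_conv)

lemma mid_in_drawing: "e \<in> E \<Longrightarrow> mid e \<in> drawing"
  using mid_in_path_image by (auto simp: drawing_def)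

lemma edge_distinct: "{x, y} \<in> E \<Longrightarrow> x \<noteq> y"
  using simple_edges[of "{x, y}"] by auto

lemma edge_subset_doubleton: "e \<in> E \<Longrightarrow> e \<subseteq> {x, y} \<Longrightarrow> e = {x, y}"
  using simple_edges[of e] by (auto simp: card_2_iff)

lemma enclosed_minus_cycle:
  assumes "K \<subseteq> E" "e \<in> enclosed K" "e \<notin> K"
  shows "mid e \<in> inside (img K)"
  using assms by (auto simp: enclosed_conv)

text \<open>The theta graph with the chord as its middle path. The list \<open>c2\<close> begins and
  ends with the ends of the chord, which makes the chord its closing edge.\<close>

lemma chord_split:
  assumes cyc: "is_cycle E (xs @ x # ys @ y # zs)" and ne: "ys \<noteq> []" "xs @ zs \<noteq> []"
    and f: "{x, y} \<in> enclosed (cycle_edges (xs @ x # ys @ y # zs))" "{x, y} \<notin> cycle_edges (xs @ x # ys @ y # zs)"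
  defines "c1 \<equiv> xs @ x # y # zs" and "c2 \<equiv> x # ys @ [y]"
  shows "is_cycle E c1" "is_cycle E c2"
    and "enclosed (cycle_edges (xs @ x # ys @ y # zs)) = enclosed (cycle_edges c1) \<union> enclosed (cycle_edges c2)"
    and "enclosed (cycle_edges c1) \<inter> enclosed (cycle_edges c2) = {{x, y}}"
    and "\<Union>(enclosed (cycle_edges c1)) \<inter> \<Union>(enclosed (cycle_edges c2)) \<subseteq> {x, y}"
proof -
  define A where "A = walk_edges (x # ys @ [y])"
  \<comment> \<open>The second walk is reversed so that all three paths run from \<open>x\<close> to
    \<open>y\<close>, as \<open>theta_split\<close> expects; its edges stay the same.\<close>
  define B where "B = walk_edges (x # rev (zs @ xs) @ [y])"
  define P where "P = walk_edges (x # [] @ [y])"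
  have B: "B = walk_edges (y # zs @ xs @ [x])"
    unfolding B_def walk_edges_rev[of "y # zs @ xs @ [x]", symmetric] by simp
  have P: "P = {{x, y}}" by (simp add: P_def)
  have c: "cycle_edges (xs @ x # ys @ y # zs) = A \<union> B"
    unfolding A_def B by (rule cycle_edges_split)
  have c1: "cycle_edges c1 = B \<union> P"
    using cycle_edges_split[of xs x "[]" y zs] by (auto simp: c1_def B P)
  have c2: "cycle_edges c2 = A \<union> P"
    using cycle_edges_split[of "[]" x ys y "[]"] by (auto simp: c2_def A_def P insert_commute)
  have dist: "distinct (xs @ x # ys @ y # zs)" and AB: "A \<subseteq> E" "B \<subseteq> E"
    using cyc c by (auto simp: is_cycle_def)
  have PE: "P \<subseteq> E" using f enclosed_subset by (auto simp: P)
  have fP: "{x, y} \<notin> A" "{x, y} \<notin> B" using f(2) c by auto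
  have disj: "A \<inter> B = {}"
  proof -
    have "e = {x, y}" if "e \<in> A" "e \<in> B" for e
    proof (rule edge_subset_doubleton)
      show "e \<in> E" using that AB by blast
      have "e \<subseteq> set (x # ys @ [y])" "e \<subseteq> set (y # zs @ xs @ [x])"
        using that Union_walk_edges_subset[of "x # ys @ [y]"] Union_walk_edges_subset[of "y # zs @ xs @ [x]"]
        unfolding A_def B by blast+
      then show "e \<subseteq> {x, y}" using dist by auto
    qed
    then show ?thesis using fP by blast
  qed
  have "mid {x, y} \<in> inside (img (A \<union> B))"
    using f c AB by (intro enclosed_minus_cycle) auto
  then have ne': "img P \<inter> inside (img (A \<union> B)) \<noteq> {}"
    using mid_in_path_image by (auto simp: P img_def)
  have AP: "A \<inter> P = {}" and BP: "B \<inter> P = {}" using fP by (simp_all add: P)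
  have lists: "distinct (x # ys @ [y])" "distinct (x # rev (zs @ xs) @ [y])" "distinct (x # [] @ [y])"
    "set ys \<inter> set (rev (zs @ xs)) = {}" "set ys \<inter> set [] = {}" "set (rev (zs @ xs)) \<inter> set [] = {}"
    using dist by auto
  note split = theta_split[OF lists, folded A_def B_def P_def, OF AB PE disj AP BP ne']
  show "is_cycle E c1"
    using dist ne(2) AB PE c1 by (cases xs; cases zs) (auto simp: is_cycle_def c1_def)
  show "is_cycle E c2"
    using dist ne(1) AB PE c2 by (cases ys) (auto simp: is_cycle_def c2_def)
  show "enclosed (cycle_edges (xs @ x # ys @ y # zs)) = enclosed (cycle_edges c1) \<union> enclosed (cycle_edges c2)"
    unfolding c c1 c2 split(1) by blast
  show "enclosed (cycle_edges c1) \<inter> enclosed (cycle_edges c2) = {{x, y}}"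
    using split(2) unfolding c1 c2 P by blast
  show "\<Union>(enclosed (cycle_edges c1)) \<inter> \<Union>(enclosed (cycle_edges c2)) \<subseteq> {x, y}"
    using split(3) unfolding c1 c2 by auto
qed

text \<open>The theta graph with the single edge \<open>pv\<close> as one outer path and the walk
  \<open>p\<close>, \<open>w\<close>, \<open>v\<close> in the middle. The triangular half encloses
  only its own three edges, so passing to \<open>c'\<close> loses nothing but
  \<open>pv\<close>.\<close>

lemma cut_triangle:
  assumes cyc: "is_cycle E (xs @ p # v # zs)" and w: "w \<notin> set (xs @ p # v # zs)"
  defines "T \<equiv> {{p, v}, {v, w}, {p, w}}"
  assumes T: "enclosed T = T" "T \<subseteq> enclosed (cycle_edges (xs @ p # v # zs))"
  defines "c' \<equiv> xs @ p # w # v # zs"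
  shows "is_cycle E c'"
    and "enclosed (cycle_edges (xs @ p # v # zs)) = insert {p, v} (enclosed (cycle_edges c'))"
    and "{p, v} \<notin> enclosed (cycle_edges c')"
proof -
  define A where "A = walk_edges (p # [] @ [v])"
  define B where "B = walk_edges (p # rev (zs @ xs) @ [v])"
  define P where "P = walk_edges (p # [w] @ [v])"
  have B: "B = walk_edges (v # zs @ xs @ [p])"
    unfolding B_def walk_edges_rev[of "v # zs @ xs @ [p]", symmetric] by simp
  have P: "P = {{p, w}, {v, w}}" and A: "A = {{p, v}}" by (auto simp: P_def A_def insert_commute)
  have c: "cycle_edges (xs @ p # v # zs) = A \<union> B"
    using cycle_edges_split[of xs p "[]" v zs] by (simp add: A_def B)
  have c': "cycle_edges c' = B \<union> P"
    using cycle_edges_split[of xs p "[w]" v zs] by (auto simp: c'_def B P insert_commute)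
  have AP: "A \<union> P = T" by (auto simp: A P T_def)
  have TE: "T \<subseteq> E" using T(2) enclosed_subset by blast
  have dist: "distinct (xs @ p # v # zs)" and AB: "A \<subseteq> E" "B \<subseteq> E" and PE: "P \<subseteq> E"
    and zx: "zs @ xs \<noteq> []"
    using cyc c TE AP by (auto simp: is_cycle_def)
  have wB: "w \<notin> \<Union>B"
    using Union_walk_edges_subset[of "v # zs @ xs @ [p]"] w by (auto simp: B)
  have pvB: "{p, v} \<notin> B"
    using doubleton_in_walk_edges[of v "zs @ xs" p] dist zx by (auto simp: B insert_commute)
  have pwv: "w \<noteq> p" "w \<noteq> v" "p \<noteq> v" using w dist by auto
  have disj: "A \<inter> B = {}" "A \<inter> P = {}" "B \<inter> P = {}"
    using wB pvB pwv by (auto simp: A P doubleton_eq_iff)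
  have "mid {p, w} \<in> inside (img (A \<union> B))"
  proof (rule enclosed_minus_cycle)
    show "A \<union> B \<subseteq> E" using AB by blast
    show "{p, w} \<in> enclosed (A \<union> B)" using T(2) unfolding c by (auto simp: T_def)
    show "{p, w} \<notin> A \<union> B" using wB pwv by (auto simp: A doubleton_eq_iff)
  qed
  then have ne: "img P \<inter> inside (img (A \<union> B)) \<noteq> {}"
    using mid_in_path_image by (auto simp: P img_def)
  have lists: "distinct (p # [] @ [v])" "distinct (p # rev (zs @ xs) @ [v])" "distinct (p # [w] @ [v])"
    "set [] \<inter> set (rev (zs @ xs)) = {}" "set [] \<inter> set [w] = {}" "set (rev (zs @ xs)) \<inter> set [w] = {}"
    using dist w by auto
  note split = theta_split[OF lists, folded A_def B_def P_def, OF AB PE disj ne]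
  show "is_cycle E c'"
    using cyc w AB PE c' by (auto simp: is_cycle_def c'_def)
  have pvP: "{p, v} \<notin> P" using disj(2) by (auto simp: A)
  show "{p, v} \<notin> enclosed (cycle_edges c')"
    using split(2) pvP T(1) unfolding c' AP by (auto simp: T_def)
  have "P \<subseteq> enclosed (cycle_edges c')" using split(2) unfolding c' by blast
  then show "enclosed (cycle_edges (xs @ p # v # zs)) = insert {p, v} (enclosed (cycle_edges c'))"
    unfolding c split(1) AP T(1) c'[symmetric] by (auto simp: T_def P)
qed

end

lemma Un_Int_singleton_Diff:
  assumes "X = X1 \<union> X2" "X1 \<inter> X2 = {f}" "e \<in> X1" "e \<noteq> f"
  shows "e \<notin> X2" "X - {e} = (X1 - {e}) \<union> (X2 - {f})" "(X1 - {e}) \<inter> (X2 - {f}) = {}"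
  using assms by auto

section \<open>Near-triangulations\<close>

context near_triangulation
begin

text \<open>The face that touches the midpoint of \<open>pv\<close> from inside the cycle is
  bounded, hence a triangle. Being a face, it contains no part of the drawing, so the triangle
  encloses only its own edges.\<close>

lemma face_at_edge:
  assumes cyc: "is_cycle E c" and g: "{p, v} \<in> cycle_edges c"
  obtains w where "w \<noteq> p" "w \<noteq> v" "p \<noteq> v"
    "enclosed {{p, v}, {v, w}, {p, w}} = {{p, v}, {v, w}, {p, w}}"
    "{{p, v}, {v, w}, {p, w}} \<subseteq> enclosed (cycle_edges c)"
proof -
  define K where "K = cycle_edges c"
  let ?g = "{p, v}"
  have KE: "K \<subseteq> E" and gE: "?g \<in> E" using cyc g by (auto simp: is_cycle_def K_def)
  obtain h where h: "simple_path h" "pathfinish h = pathstart h" "path_image h = img K"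
    using cycle_simple_path[OF cyc] by (auto simp: K_def)
  note J = Jordan_inside_outside[OF h(1,2), unfolded h(3)]
  \<comment> \<open>Everything drawn except the inner points of the arc of \<open>pv\<close>. This
    set is closed and misses the midpoint, so some ball around the midpoint meets no part of the
    drawing but this arc.\<close>
  define D where "D = pos ` V \<union> img (E - {?g})"
  have "closed D"
    unfolding D_def using finite_verts by (intro closed_Un closed_img) (auto intro: finite_imp_closed)
  moreover have "mid ?g \<notin> D"
    using mid_notin_verts[OF gE] mid_in_img_iff[OF gE, of "E - {?g}"] by (auto simp: D_def)
  ultimately obtain r where r: "r > 0" "ball (mid ?g) r \<inter> D = {}"
    by (metis Compl_iff disjoint_eq_subset_Compl open_Compl open_contains_ball_eq)
  have drawing: "drawing \<subseteq> D \<union> path_image (\<gamma> ?g)"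
    by (auto simp: drawing_def D_def img_def)
  have gK: "path_image (\<gamma> ?g) \<subseteq> img K" using g by (auto simp: img_def K_def)
  \<comment> \<open>Every point of a Jordan curve is a limit of points inside it, so the ball
    contains a point \<open>q\<close> of the inside; its face is the one wanted.\<close>
  have "mid ?g \<in> frontier (inside (img K))"
    using J gK mid_in_path_image by blast
  then have "mid ?g \<in> closure (inside (img K))" by (simp add: frontier_def)
  then obtain q where q: "q \<in> inside (img K)" "dist q (mid ?g) < r"
    using r(1) closure_approachable by blast
  have qD: "q \<in> - drawing"
  proof -
    have "q \<in> ball (mid ?g) r" using q(2) by (simp add: dist_commute)
    then have "q \<notin> D" using r(2) by blast
    moreover have "q \<notin> path_image (\<gamma> ?g)" using q(1) gK inside_no_overlap[of "img K"] by blast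
    ultimately show ?thesis using drawing by blast
  qed
  define S where "S = connected_component_set (- drawing) q"
  have S: "S \<in> faces" using qD by (auto simp: faces_def S_def components_def)
  have qS: "q \<in> S" using qD by (simp add: S_def)
  have Sd: "S \<inter> drawing = {}" using connected_component_subset[of "- drawing" q] by (auto simp: S_def)
  have conS: "connected S" by (simp add: S_def)
  have SK: "S \<subseteq> inside (img K)"
    using conS Sd img_subset_drawing[OF KE] closed_img[OF KE] qS q(1)
    by (intro connected_subset_inside) auto
  then have bS: "bounded S" using J bounded_subset by blast
  obtain t where t: "length t = 3" "is_cycle E t" "frontier S = img (cycle_edges t)"
    using inner_triangles[OF S bS] by (auto simp: bounded_by_def img_def)
  have tE: "cycle_edges t \<subseteq> E" using t(2) by (simp add: is_cycle_def)
  \<comment> \<open>The segment from \<open>q\<close> to the midpoint leaves \<open>S\<close>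
    without leaving the ball. Where it meets the frontier of \<open>S\<close> it lies on an edge of
    the triangle, and within the ball this can only be \<open>pv\<close>.\<close>
  have gt: "?g \<in> cycle_edges t"
  proof -
    have "mid ?g \<notin> S" using Sd mid_in_path_image gE by (auto simp: drawing_def)
    then have "closed_segment q (mid ?g) \<inter> frontier S \<noteq> {}"
      using qS by (intro connected_Int_frontier) auto
    then obtain z where z: "z \<in> closed_segment q (mid ?g)" "z \<in> frontier S" by blast
    have "closed_segment q (mid ?g) \<subseteq> ball (mid ?g) r"
      using q(2) r(1) by (intro closed_segment_subset) (auto simp: dist_commute)
    then have "z \<notin> D" using z(1) r(2) by blast
    moreover obtain f where f: "f \<in> cycle_edges t" "z \<in> path_image (\<gamma> f)"
      using z(2) t(3) by (auto simp: img_def)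
    ultimately have "f = ?g" using tE by (auto simp: D_def img_def)
    then show ?thesis using f by simp
  qed
  obtain k where k: "simple_path k" "pathfinish k = pathstart k" "path_image k = img (cycle_edges t)"
    using cycle_simple_path[OF t(2)] by blast
  have "S \<noteq> {}" "S \<inter> img (cycle_edges t) = {}"
    using qS Sd img_subset_drawing[OF tE] by blast+
  then have "S = inside (img (cycle_edges t))"
    using connected_eq_inside_or_outside(1)[OF k(1,2), unfolded k(3), OF conS _ t(3) _ bS] by blast
  then have et: "enclosed (cycle_edges t) = cycle_edges t"
    using Sd mid_in_drawing unfolding enclosed_conv[OF tE] by blast
  have tK: "cycle_edges t \<subseteq> enclosed K"
  proof
    fix e assume e: "e \<in> cycle_edges t"
    then have "mid e \<in> frontier S" using t(3) mid_in_path_image by (auto simp: img_def)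
    then have "mid e \<in> closure (inside (img K))"
      using closure_mono[OF SK] by (auto simp: frontier_def)
    then show "e \<in> enclosed K"
      using closure_inside_subset[OF closed_img[OF KE]] e tE by (auto simp: enclosed_def)
  qed
  obtain x y z where xyz: "t = [x, y, z]"
    using t(1) by (auto simp: numeral_3_eq_3 length_Suc_conv)
  have ce: "cycle_edges t = {{x, y}, {y, z}, {z, x}}"
    by (simp add: xyz cycle_edges_conv_walk)
  have d: "x \<noteq> y" "y \<noteq> z" "x \<noteq> z" using t(2) by (auto simp: xyz is_cycle_def)
  obtain w where "w \<noteq> p" "w \<noteq> v" "p \<noteq> v" "cycle_edges t = {{p, v}, {v, w}, {p, w}}"
  proof -
    consider "?g = {x, y}" | "?g = {y, z}" | "?g = {z, x}" using gt unfolding ce by blast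
    then show ?thesis
    proof cases
      case 1
      then have "p = x \<and> v = y \<or> p = y \<and> v = x" by (simp add: doubleton_eq_iff)
      then show ?thesis using that[of z] d by (elim disjE) (simp_all add: ce insert_commute)
    next
      case 2
      then have "p = y \<and> v = z \<or> p = z \<and> v = y" by (simp add: doubleton_eq_iff)
      then show ?thesis using that[of x] d by (elim disjE) (simp_all add: ce insert_commute)
    next
      case 3
      then have "p = z \<and> v = x \<or> p = x \<and> v = z" by (simp add: doubleton_eq_iff)
      then show ?thesis using that[of y] d by (elim disjE) (simp_all add: ce insert_commute)
    qed
  qed
  then show thesis using that et tK by (simp add: K_def)
qed

text \<open>The unbounded face has the outer cycle as its frontier, so it is the whole outside of
  that curve, and no edge has its midpoint there.\<close>

lemma outer_cycle_encloses: "is_cycle E C" "enclosed (cycle_edges C) = E"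
proof -
  obtain S where S: "S \<in> faces" "\<not> bounded S"
    using cobounded_unbounded_components[of "- drawing"] compact_drawing
    by (auto simp: faces_def compact_imp_bounded)
  then have C: "is_cycle E C" "frontier S = img (cycle_edges C)"
    using outer_cycle by (auto simp: bounded_by_def img_def)
  then have CE: "cycle_edges C \<subseteq> E" by (simp add: is_cycle_def)
  have Sd: "S \<inter> drawing = {}" "connected S" "S \<noteq> {}"
    using S in_components_subset in_components_connected in_components_nonempty by (auto simp: faces_def)
  obtain k where k: "simple_path k" "pathfinish k = pathstart k" "path_image k = img (cycle_edges C)"
    using cycle_simple_path[OF C(1)] by blast
  have "S = outside (img (cycle_edges C))"
    using connected_eq_inside_or_outside(2)[OF k(1,2), unfolded k(3), OF Sd(2,3) C(2) _ S(2)]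
      Sd(1) img_subset_drawing[OF CE] by blast
  then have "mid e \<notin> outside (img (cycle_edges C))" if "e \<in> E" for e
    using Sd(1) mid_in_drawing[OF that] by blast
  then have "E \<subseteq> enclosed (cycle_edges C)"
    unfolding enclosed_def using inside_Un_outside[of "img (cycle_edges C)"] by blast
  then show "is_cycle E C" "enclosed (cycle_edges C) = E"
    using C(1) enclosed_subset by blast+
qed

text \<open>The neighbours of \<open>v\<close> are found one by one: cut off the triangle at the edge \<open>pv\<close> and continue
  with its third vertex in the place of \<open>p\<close>.\<close>

lemma remove_boundary_vertex:
  assumes "is_cycle E (xs @ p # v # q # zs)"
    and "\<forall>w\<in>set (xs @ p # v # q # zs). {v, w} \<in> enclosed (cycle_edges (xs @ p # v # q # zs)) \<longrightarrow> w \<in> {p, q}"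
  shows "xs = [] \<and> zs = [] \<and> enclosed (cycle_edges (xs @ p # v # q # zs)) = {{p, v}, {v, q}, {p, q}} \<or>
    (\<exists>us. is_cycle E (xs @ p # us @ q # zs) \<and> set us \<inter> set (xs @ p # v # q # zs) = {} \<and>
      enclosed (cycle_edges (xs @ p # v # q # zs)) =
        enclosed (cycle_edges (xs @ p # us @ q # zs)) \<union> star v (insert p (insert q (set us))) \<and>
      v \<notin> \<Union>(enclosed (cycle_edges (xs @ p # us @ q # zs))))"
  using assms
proof (induction "card (enclosed (cycle_edges (xs @ p # v # q # zs)))" arbitrary: xs p rule: less_induct)
  case less
  let ?c = "xs @ p # v # q # zs"
  note cyc = less.prems(1) and nochord = less.prems(2)
  have dist: "distinct ?c" using cyc by (simp add: is_cycle_def)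
  have ce: "cycle_edges ?c = {{p, v}, {v, q}} \<union> walk_edges (q # zs @ xs @ [p])"
    using cycle_edges_split[of xs p "[v]" q zs] by simp
  then have "{p, v} \<in> cycle_edges ?c" by simp
  then obtain w where w: "w \<noteq> p" "w \<noteq> v"
    and T: "enclosed {{p, v}, {v, w}, {p, w}} = {{p, v}, {v, w}, {p, w}}"
      "{{p, v}, {v, w}, {p, w}} \<subseteq> enclosed (cycle_edges ?c)"
    using face_at_edge[OF cyc] by metis
  show ?case
  proof (cases "w \<in> set ?c")
    case True
    then have wq: "w = q" using nochord T(2) w by blast
    show ?thesis
    \<comment> \<open>The path of neighbours has reached \<open>q\<close>. Either \<open>pq\<close>
      is a cycle edge and the cycle is a triangle, or it is a chord that cuts off the triangle at
      \<open>v\<close>; then no neighbours remain and \<open>us\<close> is empty.\<close>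
    proof (cases "{p, q} \<in> cycle_edges ?c")
      case True
      then have "{q, p} \<in> walk_edges (q # zs @ xs @ [p])"
        using dist by (auto simp: ce doubleton_eq_iff insert_commute)
      then have "zs @ xs = []"
        using doubleton_in_walk_edges[of q "zs @ xs" p] dist by auto
      then have "xs = []" "zs = []" by auto
      moreover have "cycle_edges [p, v, q] = {{p, v}, {v, q}, {p, q}}"
        by (auto simp: cycle_edges_conv_walk insert_commute)
      ultimately show ?thesis using T(1) wq by simp
    next
      case False
      have ne: "xs @ zs \<noteq> []"
        using False by (auto simp: ce insert_commute)
      have fE: "{p, q} \<in> enclosed (cycle_edges (xs @ p # [v] @ q # zs))" using T(2) wq by simp
      note split = chord_split[of xs p "[v]" q zs, simplified, OF _ _ fE[simplified] False, simplified]
      have "is_cycle E ?c" "xs = [] \<longrightarrow> zs \<noteq> []" using cyc ne by auto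
      note split = split[OF this]
      have tri: "cycle_edges [p, v, q] = {{p, v}, {v, q}, {p, q}}"
        by (auto simp: cycle_edges_conv_walk insert_commute)
      have et: "enclosed (cycle_edges [p, v, q]) = {{p, v}, {v, q}, {p, q}}"
        using T(1) wq tri by simp
      have "v \<notin> \<Union>(enclosed (cycle_edges (xs @ p # q # zs)))"
        using split(5) et dist by auto
      moreover have "enclosed (cycle_edges ?c) =
        enclosed (cycle_edges (xs @ p # q # zs)) \<union> star v {p, q}"
      proof -
        have "{p, q} \<in> enclosed (cycle_edges (xs @ p # q # zs))"
          using split(4) by blast
        moreover have "star v {p, q} = {{p, v}, {v, q}}"
          by (auto simp: star_def insert_commute)
        ultimately show ?thesis using split(3) unfolding et by blast
      qed
      ultimately have "is_cycle E (xs @ p # [] @ q # zs) \<and> set [] \<inter> set ?c = {} \<and>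
        enclosed (cycle_edges ?c) =
          enclosed (cycle_edges (xs @ p # [] @ q # zs)) \<union> star v (insert p (insert q (set []))) \<and>
        v \<notin> \<Union>(enclosed (cycle_edges (xs @ p # [] @ q # zs)))"
        using split(1) by simp
      then show ?thesis by (rule disjI2[OF exI])
    qed
  next
    case False
    note cut = cut_triangle[OF cyc False T]
    let ?c'' = "(xs @ [p]) @ w # v # q # zs"
    have enc: "enclosed (cycle_edges ?c) = insert {p, v} (enclosed (cycle_edges ?c''))"
      and pv: "{p, v} \<notin> enclosed (cycle_edges ?c'')" and cyc'': "is_cycle E ?c''"
      using cut by simp_all
    have smaller: "card (enclosed (cycle_edges ?c'')) < card (enclosed (cycle_edges ?c))"
      using enc pv finite_enclosed by simp
    \<comment> \<open>After the cut \<open>w\<close> takes the place of \<open>p\<close>, and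
      \<open>p\<close> becomes an ordinary cycle vertex. It gives no chord at \<open>v\<close>,
      since \<open>pv\<close> is no longer enclosed.\<close>
    have nochord'': "\<forall>u\<in>set ?c''. {v, u} \<in> enclosed (cycle_edges ?c'') \<longrightarrow> u \<in> {w, q}"
    proof (intro ballI impI, rule ccontr)
      fix u assume u: "u \<in> set ?c''" and uv: "{v, u} \<in> enclosed (cycle_edges ?c'')" and "u \<notin> {w, q}"
      then have "u \<in> set ?c" "{v, u} \<in> enclosed (cycle_edges ?c)" using enc by auto
      then have "u \<in> {p, q}" using nochord by blast
      then show False using \<open>u \<notin> {w, q}\<close> uv pv by (auto simp: insert_commute)
    qed
    \<comment> \<open>The triangle alternative is impossible because \<open>xs @ [p]\<close> is not
      empty.\<close>
    from less.hyps[OF smaller cyc'' nochord'']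
    obtain us where us: "is_cycle E ((xs @ [p]) @ w # us @ q # zs)" "set us \<inter> set ?c'' = {}"
      "enclosed (cycle_edges ?c'') =
        enclosed (cycle_edges ((xs @ [p]) @ w # us @ q # zs)) \<union> star v (insert w (insert q (set us)))"
      "v \<notin> \<Union>(enclosed (cycle_edges ((xs @ [p]) @ w # us @ q # zs)))"
      by (elim disjE exE conjE) (simp, erule (3) that)
    have "star v (insert p (insert q (set (w # us)))) = insert {p, v} (star v (insert w (insert q (set us))))"
      by (auto simp: star_def insert_commute)
    then have "enclosed (cycle_edges ?c) =
        enclosed (cycle_edges (xs @ p # (w # us) @ q # zs)) \<union> star v (insert p (insert q (set (w # us))))"
      using enc us(3) by simp
    then have "is_cycle E (xs @ p # (w # us) @ q # zs) \<and> set (w # us) \<inter> set ?c = {} \<and>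
        enclosed (cycle_edges ?c) =
          enclosed (cycle_edges (xs @ p # (w # us) @ q # zs)) \<union> star v (insert p (insert q (set (w # us)))) \<and>
        v \<notin> \<Union>(enclosed (cycle_edges (xs @ p # (w # us) @ q # zs)))"
      using us(1,2,4) False by simp
    then show ?thesis by (rule disjI2[OF exI])
  qed
qed

text \<open>The root edge is encoded as the closing edge of the list. The induction counts enclosed
  edges, a number that drops both when a chord splits the enclosed part and when \<open>v\<close> is
  deleted.\<close>

lemma nice_mono_exists:
  fixes ends :: "'v set \<Rightarrow> 'v \<times> 'v"
  assumes ord: "edge_ordering E ends" and "is_cycle E c"
  shows "\<exists>m \<in> Poly_Mapping.keys (Q_poly (enclosed (cycle_edges c) - {{hd c, last c}}) ends :: ('v, 'f::field) laurent_poly).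
    nice_mono {hd c, last c} (set c) m"
  using assms(2)
proof (induction "card (enclosed (cycle_edges c))" arbitrary: c rule: less_induct)
  case less
  note IH = less.hyps and cyc = less.prems
  obtain a v q r where c: "c = a # v # q # r"
    using cyc by (auto simp: is_cycle_def numeral_3_eq_3 Suc_le_length_iff)
  define b where "b = last (q # r)"
  have hl: "hd c = a" "last c = b" by (simp_all add: c b_def)
  have dist: "distinct c" using cyc by (simp add: is_cycle_def)
  have b: "b \<in> set (q # r)" unfolding b_def by (rule last_in_set) simp
  have ab: "a \<noteq> b" "v \<noteq> b" "a \<noteq> v" "a \<noteq> q" "v \<noteq> q" using b dist by (auto simp: c)
  have two: "\<forall>e\<in>F. card e = 2" if "F \<subseteq> E" for F using that simple_edges by blast
  have ord': "edge_ordering F ends" if "F \<subseteq> E" for F using that ord by (auto simp: edge_ordering_def)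
  show ?case
  proof (cases "\<exists>w\<in>set c. {v, w} \<in> enclosed (cycle_edges c) \<and> w \<notin> {a, q}")
    case True
    then obtain w where w: "w \<in> set c" "{v, w} \<in> enclosed (cycle_edges c)" "w \<noteq> a" "w \<noteq> q" by blast
    have "w \<noteq> v" using w(2) enclosed_subset edge_distinct by blast
    then have "w \<in> set r" using w by (auto simp: c)
    then obtain ys zs where r: "r = ys @ w # zs" by (meson split_list)
    have c': "c = [a] @ v # (q # ys) @ w # zs" by (simp add: c r)
    have "{v, w} \<notin> cycle_edges c"
      using doubleton_in_walk_edges[of v "q # ys" w] doubleton_in_walk_edges[of w "zs @ [a]" v] dist
      unfolding c' cycle_edges_split by (auto simp: insert_commute)
    note split = chord_split[OF cyc[unfolded c'] _ _ w(2)[unfolded c'] this[unfolded c']]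
    define c1 where "c1 = [a] @ v # w # zs"
    define c2 where "c2 = v # (q # ys) @ [w]"
    have cyc1: "is_cycle E c1" and cyc2: "is_cycle E c2"
      and enc: "enclosed (cycle_edges c) = enclosed (cycle_edges c1) \<union> enclosed (cycle_edges c2)"
      and int: "enclosed (cycle_edges c1) \<inter> enclosed (cycle_edges c2) = {{v, w}}"
      and verts: "\<Union>(enclosed (cycle_edges c1)) \<inter> \<Union>(enclosed (cycle_edges c2)) \<subseteq> {v, w}"
      using split by (simp_all add: c1_def c2_def c')
    have hl1: "hd c1 = a" "last c1 = b" by (simp_all add: c1_def b_def r)
    have hl2: "hd c2 = v" "last c2 = w" by (simp_all add: c2_def)
    have ce1: "cycle_edges c1 \<subseteq> enclosed (cycle_edges c1)" and ce2: "cycle_edges c2 \<subseteq> enclosed (cycle_edges c2)"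
      using cyc1 cyc2 by (auto simp: is_cycle_def intro: subset_enclosed[THEN subsetD])
    have set1: "set c1 \<subseteq> \<Union>(enclosed (cycle_edges c1))" and set2: "set c2 \<subseteq> \<Union>(enclosed (cycle_edges c2))"
      using Union_mono[OF ce1] Union_mono[OF ce2] Union_cycle_edges[of c1] Union_cycle_edges[of c2] cyc1 cyc2
      by (simp_all add: is_cycle_def)
    have "{a, b} \<in> cycle_edges c1"
      using hd_last_in_cycle_edges[of c1] hl1 by (simp add: c1_def)
    then have ab1: "{a, b} \<in> enclosed (cycle_edges c1)" using ce1 by blast
    have vw: "{a, b} \<noteq> {v, w}" using ab w by (auto simp: doubleton_eq_iff)
    note parts = Un_Int_singleton_Diff[OF enc int ab1 this]
    \<comment> \<open>The edge \<open>vq\<close> is enclosed only on the second side and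
      \<open>ab\<close> only on the first, so both sides have fewer edges.\<close>
    have "{v, q} \<in> cycle_edges c2" by (simp add: c2_def cycle_edges_conv_walk)
    then have "{v, q} \<in> enclosed (cycle_edges c2)" using ce2 by blast
    moreover have "{v, q} \<noteq> {v, w}" using w by (auto simp: doubleton_eq_iff)
    ultimately have vq1: "{v, q} \<notin> enclosed (cycle_edges c1)" "{v, q} \<in> enclosed (cycle_edges c)"
      using Un_Int_singleton_Diff(1)[of _ "enclosed (cycle_edges c2)" "enclosed (cycle_edges c1)"] int enc
      by (simp_all add: Int_commute)
    have small1: "card (enclosed (cycle_edges c1)) < card (enclosed (cycle_edges c))"
      using vq1 enc by (intro psubset_card_mono finite_enclosed) blast
    have small2: "card (enclosed (cycle_edges c2)) < card (enclosed (cycle_edges c))"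
      using ab1 parts(1) enc by (intro psubset_card_mono finite_enclosed) blast
    \<comment> \<open>The chord is kept in \<open>F1\<close> and removed from \<open>F2\<close> as
      its root edge, so it is counted exactly once.\<close>
    define F1 where "F1 = enclosed (cycle_edges c1) - {{a, b}}"
    define F2 where "F2 = enclosed (cycle_edges c2) - {{v, w}}"
    obtain m1 where m1: "m1 \<in> Poly_Mapping.keys (Q_poly F1 ends :: ('v, 'f) laurent_poly)" "nice_mono {a, b} (set c1) m1"
      using IH[OF small1 cyc1] unfolding hl1 F1_def by blast
    obtain m2 where m2: "m2 \<in> Poly_Mapping.keys (Q_poly F2 ends :: ('v, 'f) laurent_poly)" "nice_mono {v, w} (set c2) m2"
      using IH[OF small2 cyc2] unfolding hl2 F2_def by blast
    have F: "enclosed (cycle_edges c) - {{a, b}} = F1 \<union> F2"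
      using parts(2) unfolding F1_def F2_def .
    have FE: "F1 \<subseteq> E" "F2 \<subseteq> E" using enclosed_subset unfolding F1_def F2_def by blast+
    have sets: "set c = set c1 \<union> set c2" by (auto simp: c' c1_def c2_def)
    have UF: "\<Union>F1 \<subseteq> \<Union>(enclosed (cycle_edges c1))" "\<Union>F2 \<subseteq> \<Union>(enclosed (cycle_edges c2))"
      unfolding F1_def F2_def by blast+
    have "\<exists>m \<in> Poly_Mapping.keys (Q_poly (F1 \<union> F2) ends :: ('v, 'f) laurent_poly). nice_mono {a, b} (set c1 \<union> set c2) m"
    proof (rule nice_mono_glue[OF _ _ _ _ _ _ _ _ _ _ _ m1 m2])
      show "finite F1" "finite F2" by (simp_all add: F1_def F2_def finite_enclosed)
      show "F1 \<inter> F2 = {}" using parts(3) unfolding F1_def F2_def .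
      show "edge_ordering (F1 \<union> F2) ends" "\<forall>e\<in>F1 \<union> F2. card e = 2"
        using FE ord'[of "F1 \<union> F2"] two[of "F1 \<union> F2"] by simp_all
      show "\<Union>F1 \<inter> \<Union>F2 \<subseteq> {v, w}" using verts UF by blast
      show "set c1 \<inter> \<Union>F2 \<subseteq> {v, w}" using verts UF set1 by blast
      show "set c2 \<inter> \<Union>F1 \<subseteq> {v, w}" using verts UF set2 by blast
      show "v \<in> set c1" "w \<in> set c1" by (simp_all add: c1_def)
      show "{a, b} \<subseteq> set c1" 
          using hl1 by (metis c1_def append_is_Nil_conv hd_in_set insert_subset empty_subsetI last_in_set list.distinct(1))
    qed
    then show ?thesis unfolding hl F sets .
  next
    case False
    then have nochord: "\<forall>w\<in>set ([] @ a # v # q # r).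
      {v, w} \<in> enclosed (cycle_edges ([] @ a # v # q # r)) \<longrightarrow> w \<in> {a, q}"
      by (simp add: c)
    have cyc0: "is_cycle E ([] @ a # v # q # r)" using cyc by (simp add: c)
    from remove_boundary_vertex[OF cyc0 nochord]
    consider "r = []" "enclosed (cycle_edges c) = {{a, v}, {v, q}, {a, q}}"
      | us where "is_cycle E (a # us @ q # r)" "set us \<inter> set c = {}"
        "enclosed (cycle_edges c) = enclosed (cycle_edges (a # us @ q # r)) \<union> star v (insert a (insert q (set us)))"
        "v \<notin> \<Union>(enclosed (cycle_edges (a # us @ q # r)))"
      unfolding c by auto
    then show ?thesis
    proof cases
      case 1
      have bq: "b = q" using 1 by (simp add: b_def)
      have F: "enclosed (cycle_edges c) - {{a, q}} = star v {a, q}"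
        unfolding 1(2) using ab by (auto simp: star_def doubleton_eq_iff insert_commute)
      have "star v {a, q} \<subseteq> E" using F enclosed_subset by blast
      moreover have "set c = {a, v, q}" using 1 by (simp add: c)
      ultimately show ?thesis
        unfolding hl bq F using nice_mono_path[OF ord', of v a q] ab by auto
    next
      case (2 us)
      let ?c' = "a # us @ q # r"
      let ?N = "insert a (insert q (set us))"
      have hl': "hd ?c' = a" "last ?c' = b" by (simp_all add: b_def)
      define F where "F = enclosed (cycle_edges ?c') - {{a, b}}"
      have vF: "v \<notin> \<Union>F" using 2(4) unfolding F_def by blast
      have "{a, v} \<notin> enclosed (cycle_edges ?c')" using 2(4) by blast
      moreover have "{a, v} \<in> enclosed (cycle_edges c)" unfolding 2(3) by (auto simp: star_def)
      ultimately have small: "card (enclosed (cycle_edges ?c')) < card (enclosed (cycle_edges c))"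
        using 2(3) by (intro psubset_card_mono finite_enclosed) blast
      obtain m where m: "m \<in> Poly_Mapping.keys (Q_poly F ends :: ('v, 'f) laurent_poly)" "nice_mono {a, b} (set ?c') m"
        using IH[OF small 2(1)] unfolding hl' F_def by blast
      have "{a, b} \<notin> star v ?N"
        using ab by (auto simp: star_def doubleton_eq_iff)
      then have FE: "enclosed (cycle_edges c) - {{a, b}} = F \<union> star v ?N"
        unfolding 2(3) F_def by blast
      have sub: "F \<union> star v ?N \<subseteq> E" using FE enclosed_subset by blast
      \<comment> \<open>Deleting \<open>v\<close> exposes \<open>us\<close>, so the induction
        hypothesis bounds the exponents there by -2 instead of -4. This slack pays for the star
        edges.\<close>
      have set': "set ?c' = set c - {v} \<union> set us" using dist 2(2) by (auto simp: c)
      have "\<exists>m\<in>Poly_Mapping.keys (Q_poly (F \<union> star v ?N) ends :: ('v, 'f) laurent_poly). nice_mono {a, b} (set c) m"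
      proof (rule nice_mono_add_star[OF _ _ _ _ _ _ _ _ _ _ _ _ _ _ _ _ m(1) m(2)[unfolded set']])
        show "finite F" by (simp add: F_def finite_enclosed)
        show "edge_ordering (F \<union> star v ?N) ends" "\<forall>e\<in>F. card e = 2" using sub ord' two by auto
        show "v \<notin> \<Union>F" by (rule vF)
        show "v \<notin> ?N" "a \<noteq> q" "a \<notin> set us" "q \<notin> set us" "a \<noteq> b" "set us \<inter> set c = {}" "v \<noteq> b"
          "a \<in> set c" "b \<in> set c" "q \<in> set c" "v \<in> set c"
          using ab 2(2) b by (auto simp: c)
      qed simp_all
      then show ?thesis unfolding hl FE .
    qed
  qed
qed

end

section \<open>Multiplication by R and conclusion for the outer cycle\<close>

lemma R_poly_eq_single:
  fixes V :: "'v set"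
  assumes "finite V"
  shows "\<exists>r. R_poly V C e = (Poly_Mapping.single r 1 :: ('v, 'f::field) laurent_poly) \<and>
    (\<forall>x. Poly_Mapping.lookup r x = (if x \<in> set C - e then 2 else 0) + (if x \<in> V - set C then 4 else 0))"
proof -
  have pow: "(lvar x :: ('v, 'f) laurent_poly) ^ n = Poly_Mapping.single (Poly_Mapping.single x (int n)) 1" for x n
    by (induction n) (simp_all add: lvar_def mult_single single_add[symmetric])
  have prod: "(\<Prod>x\<in>A. Poly_Mapping.single (f x) 1 :: ('v, 'f) laurent_poly) = Poly_Mapping.single (\<Sum>x\<in>A. f x) 1"
    for f :: "'v \<Rightarrow> 'v \<Rightarrow>\<^sub>0 int" and A
    by (induction A rule: infinite_finite_induct) (simp_all add: mult_single)
  show ?thesis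
    unfolding R_poly_def pow prod mult_single
    using assms by (intro exI conjI allI, simp) (simp add: lookup_add lookup_sum lookup_single when_def)
qed

theorem theorem1:
  fixes V :: "'v set" and E :: "'v set set"
    and pos :: "'v \<Rightarrow> complex" and \<gamma> :: "'v set \<Rightarrow> real \<Rightarrow> complex"
    and C :: "'v list" and a b :: 'v
    and ends :: "'v set \<Rightarrow> 'v \<times> 'v"
  assumes "near_triangulation V E pos \<gamma> C"
    and "{a, b} \<in> cycle_edges C"
    and "edge_ordering (E - {{a, b}}) ends"
  shows "good (Q_poly (E - {{a, b}}) ends * R_poly V C {a, b} :: ('v, 'f :: field) laurent_poly)"
proof -
  interpret near_triangulation V E pos \<gamma> C by fact
  note C = outer_cycle_encloses
  have CE: "cycle_edges C \<subseteq> E" and len: "3 \<le> length C" and dist: "distinct C"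
    using C(1) by (auto simp: is_cycle_def)
  obtain i where i: "i < length C" "{a, b} = {C ! i, C ! (Suc i mod length C)}"
    using assms(2) by (auto simp: cycle_edges_def)
  \<comment> \<open>The rotation that makes the given edge the closing one: the list ends with
    \<open>C ! i\<close> and begins with its cyclic successor.\<close>
  define c where "c = drop (Suc i) C @ take (Suc i) C"
  have cC: "cycle_edges c = cycle_edges C"
    unfolding c_def using cycle_edges_append_commute[of "drop (Suc i) C" "take (Suc i) C"] by simp
  have setc: "set c = set C"
    unfolding c_def by (metis append_take_drop_id set_append Un_commute)
  have cyc: "is_cycle E c"
    using C(1) cC dist len set_take_disj_set_drop_if_distinct[OF dist, of "Suc i" "Suc i"]
    by (auto simp: is_cycle_def c_def)
  have "last c = C ! i"
    using i(1) by (simp add: c_def take_Suc_conv_app_nth)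
  moreover have "hd c = C ! (Suc i mod length C)"
  proof (cases "Suc i = length C")
    case True
    then show ?thesis using len by (cases C) (auto simp: c_def)
  next
    case False
    then show ?thesis using i(1) by (simp add: c_def hd_drop_conv_nth)
  qed
  ultimately have ab: "{hd c, last c} = {a, b}" using i(2) by auto
  \<comment> \<open>The induction uses an ordering on all of \<open>E\<close>, so the deleted edge
    receives an arbitrary one. The product over the remaining edges does not change.\<close>
  define ends' where "ends' = ends({a, b} := (a, b))"
  have "edge_ordering E ends'"
    using assms(3) by (auto simp: ends'_def edge_ordering_def)
  from nice_mono_exists[OF this cyc] obtain m
    where "m \<in> Poly_Mapping.keys (Q_poly (E - {{a, b}}) ends' :: ('v, 'f) laurent_poly)"
      and nice: "nice_mono {a, b} (set C) m"
    unfolding cC C(2) ab setc by blast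
  moreover have "Q_poly (E - {{a, b}}) ends' = (Q_poly (E - {{a, b}}) ends :: ('v, 'f) laurent_poly)"
    unfolding Q_poly_def by (intro prod.cong) (auto simp: ends'_def)
  ultimately have m: "m \<in> Poly_Mapping.keys (Q_poly (E - {{a, b}}) ends :: ('v, 'f) laurent_poly)"
    by simp
  obtain r where R: "R_poly V C {a, b} = (Poly_Mapping.single r 1 :: ('v, 'f) laurent_poly)"
    and r: "\<And>x. Poly_Mapping.lookup r x = (if x \<in> set C - {a, b} then 2 else 0) + (if x \<in> V - set C then 4 else 0)"
    using R_poly_eq_single[OF finite_verts] by metis
  \<comment> \<open>Since \<open>R\<close> is a single monomial, multiplying by it only shifts
    exponents and cannot cause cancellation.\<close>
  have "Poly_Mapping.lookup (Q_poly (E - {{a, b}}) ends * R_poly V C {a, b} :: ('v, 'f) laurent_poly) (m + r) =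
      Poly_Mapping.lookup (Q_poly (E - {{a, b}}) ends :: ('v, 'f) laurent_poly) m * Poly_Mapping.lookup (Poly_Mapping.single r (1 :: 'f)) r"
    unfolding R by (rule lookup_mult_unique_pair) simp
  then have "Poly_Mapping.lookup (Q_poly (E - {{a, b}}) ends * R_poly V C {a, b} :: ('v, 'f) laurent_poly) (m + r) \<noteq> 0"
    using m by (simp add: in_keys_iff)
  moreover have "0 \<le> Poly_Mapping.lookup (m + r) x" for x
  proof -
    \<comment> \<open>Outside \<open>V\<close> the monomial of \<open>R\<close> contributes nothing
      and niceness gives only -4, so the support of \<open>m\<close> is needed.\<close>
    have "Poly_Mapping.lookup m x = 0" if "x \<notin> V"
      using keys_Q_poly(2)[OF _ assms(3) _ m] finite_edges simple_edges that by blast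
    moreover have "set C \<subseteq> V"
      using Union_cycle_edges[of C] len CE simple_edges by fastforce
    moreover have "x \<in> {a, b} \<Longrightarrow> Poly_Mapping.lookup m x = 0" "x \<in> set C \<Longrightarrow> -2 \<le> Poly_Mapping.lookup m x"
      "-4 \<le> Poly_Mapping.lookup m x"
      using nice by (auto simp: nice_mono_def)
    ultimately show ?thesis
      using r[of x] by (auto simp: lookup_add split: if_splits)
  qed
  ultimately show ?thesis unfolding good_def by blast
qed

end
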